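(* For a Borel probability measure $\sigma$ on $Y$, $x\in X$ and $n\in\mathbb N$ put $\Phi_n^\sigma(x)=\log\dfrac{\langle\mathcal L_x^{n+1}\mathbb 1,\sigma\rangle}{\langle\mathcal L_{fx}^{n}\mathbb 1,\sigma\rangle}$. There exist $\tau\in(0,1)$ and $C_1>0$ such that for all $k\in\mathbb N$, all $n,m\ge k$, all $x\in X$ and all Borel probability measures $\sigma_n,\sigma_m$ on $Y$, $$|\Phi_n^{\sigma_n}(x)-\Phi_m^{\sigma_m}(x)|\le C_1\tau^k.$$ Consequently $\Phi(x)=\lim_{n\to\infty}\Phi_n^{\sigma_n}(x)$ exists, is independent of the choice of $(\sigma_n)$, and $|\Phi_n^{\sigma_n}(x)-\Phi(x)|\le C_1\tau^n$.
   Context: Standing setting. $X$ and $Y$ are compact connected Riemannian manifolds, $X\times Y$ has the metric $d((x,y),(x',y'))=d_X(x,x')+d_Y(y,y')$. $F(x,y)=(f(x),g_x(y))$ is a skew product which is a Lipschitz local homeomorphism; $Y_x=\{x\}\times Y$ is identified with $Y$. $f$ is uniformly expanding: there are $\gamma>1$, $\delta_f>0$ with $d_X(fx,fx')\ge\gamma d_X(x,x')$ whenever $d_X(x,x')\le\delta_f$. Every $y$ has exactly $d$ preimages under each $g_x$. There is a continuous function $L(\cdot,\cdot)$ such that each $z$ has a neighbourhood $U_z$ on which $F$ is injective and the inverse of $F|_{U_z}$ is $L(z)$-Lipschitz on $F(U_z)$. There are $L\ge1$ and open $\mathcal A\subset X\times Y$ with: (A1) $L(z)\le L$ on $\mathcal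 A$ and $L(z)<\gamma^{-1}$ off $\mathcal A$; (A2) a finite cover $\mathcal U$ of $X\times Y$ by open sets on which $F$ is injective, with $\mathcal A$ covered by $q<d$ elements of $\mathcal U$ and each element of $\mathcal U$ meeting at most one curve of $F^{-1}(c)$ for every distance-minimizing geodesic $c$. The potential $\varphi$ is $\alpha$-Hölder ($0<\alpha<1$) satisfying (P): $\sup\varphi-\inf\varphi<\varepsilon_\varphi$ and $|e^\varphi|_\alpha<\varepsilon_\varphi e^{\inf\varphi}$, where $\varepsilon_\varphi>0$ satisfies $s:=e^{\varepsilon_\varphi}\frac{(d-q)\gamma^{-\alpha}+qL^\alpha}{d}<1$ and $s+2s\varepsilon_\varphi\,\mathrm{diam}(Y)^\alpha<1$. Fiberwise operators: $\mathcal L_x\colon C(Y_x)\to C(Y_{fx})$, $\mathcal L_x\psi(y)=\sum_{\bar y\in g_x^{-1}(y)}e^{\varphi(x,\bar y)}\psi(\bar y)$, $\mathcal L_x^n=\mathcal L_{f^{n-1}x}\circ\cdots\circ\mathcal L_x$; $\langle\psi,\sigma\rangle=\int\psi\,d\sigma$; $\mathbb 1$ is the constant function 1. *)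

theory Defs
  imports "HOL-Probability.Probability"
begin

definition pdist :: "('a::metric_space \<times> 'b::metric_space) \<Rightarrow> ('a \<times> 'b) \<Rightarrow> real" where
  "pdist z w = dist (fst z) (fst w) + dist (snd z) (snd w)"

definition min_geodesic :: "('p \<Rightarrow> 'p \<Rightarrow> real) \<Rightarrow> real \<Rightarrow> (real \<Rightarrow> 'p) \<Rightarrow> bool" where
  "min_geodesic D l c \<longleftrightarrow> 0 \<le> l \<and> (\<forall>s\<in>{0..l}. \<forall>t\<in>{0..l}. D (c s) (c t) = \<bar>s - t\<bar>)"

text \<open>Every two points are joined by a distance-minimizing geodesic
  (Hopf--Rinow for compact connected Riemannian manifolds).\<close>
definition geodesic_space :: "('p \<Rightarrow> 'p \<Rightarrow> real) \<Rightarrow> bool" where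
  "geodesic_space D \<longleftrightarrow> (\<forall>p q. \<exists>l c. min_geodesic D l c \<and> c 0 = p \<and> c l = q)"

definition local_homeo :: "('p::topological_space \<Rightarrow> 'p) \<Rightarrow> bool" where
  "local_homeo F \<longleftrightarrow> (\<forall>z. \<exists>U. open U \<and> z \<in> U \<and> open (F ` U) \<and>
        homeomorphism U (F ` U) F (inv_into U F))"

definition skew :: "('a \<Rightarrow> 'a) \<Rightarrow> ('a \<Rightarrow> 'b \<Rightarrow> 'b) \<Rightarrow> 'a \<times> 'b \<Rightarrow> 'a \<times> 'b" where
  "skew f g z = (f (fst z), g (fst z) (snd z))"

definition holder_seminorm :: "real \<Rightarrow> ('a::metric_space \<times> 'b::metric_space \<Rightarrow> real) \<Rightarrow> real" where
  "holder_seminorm \<alpha> h = (SUP p \<in> {(z,w). z \<noteq> w}. \<bar>h (fst p) - h (snd p)\<bar> / pdist (fst p) (snd p) powr \<alpha>)"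

definition Lop :: "('a \<Rightarrow> 'b \<Rightarrow> 'b) \<Rightarrow> ('a \<times> 'b \<Rightarrow> real) \<Rightarrow> 'a \<Rightarrow> ('b \<Rightarrow> real) \<Rightarrow> 'b \<Rightarrow> real" where
  "Lop g \<phi> x \<psi> y = (\<Sum>y' \<in> {y'. g x y' = y}. exp (\<phi> (x, y')) * \<psi> y')"

fun Lpow :: "('a \<Rightarrow> 'a) \<Rightarrow> ('a \<Rightarrow> 'b \<Rightarrow> 'b) \<Rightarrow> ('a \<times> 'b \<Rightarrow> real) \<Rightarrow> nat \<Rightarrow> 'a \<Rightarrow> ('b \<Rightarrow> real) \<Rightarrow> 'b \<Rightarrow> real" where
  "Lpow f g \<phi> 0 x \<psi> = \<psi>"
| "Lpow f g \<phi> (Suc n) x \<psi> = Lop g \<phi> ((f ^^ n) x) (Lpow f g \<phi> n x \<psi>)"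

definition borel_prob :: "'b::topological_space measure \<Rightarrow> bool" where
  "borel_prob \<sigma> \<longleftrightarrow> prob_space \<sigma> \<and> sets \<sigma> = sets (borel :: 'b measure)"

definition Phi_n :: "('a \<Rightarrow> 'a) \<Rightarrow> ('a \<Rightarrow> 'b \<Rightarrow> 'b) \<Rightarrow> ('a \<times> 'b \<Rightarrow> real) \<Rightarrow> nat \<Rightarrow> 'b measure \<Rightarrow> 'a \<Rightarrow> real" where
  "Phi_n f g \<phi> n \<sigma> x =
     ln ((\<integral>y. Lpow f g \<phi> (Suc n) x (\<lambda>_. 1) y \<partial>\<sigma>) / (\<integral>y. Lpow f g \<phi> n (f x) (\<lambda>_. 1) y \<partial>\<sigma>))"

end

theory Submission
  imports Defs
begin

text \<open>Lifting minimizing geodesics through \<open>F\<close> matches the \<open>d\<close> preimages of two points of a fibre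
  so that at most \<open>q\<close> matched pairs are expanded (by a factor at most \<open>L\<close>), while all others are
  contracted by \<open>1 / \<gamma>\<close>. Hence the fibre operators map the cone of functions
  whose Hoelder seminorm is at most \<open>\<kappa>\<close> times their infimum into the cone with the smaller constant
  \<open>\<kappa> - 1\<close>. By Birkhoff's argument, done by hand, the optimal constants in the cone order
  \<open>m v \<preceq> u \<preceq> M v\<close> satisfy \<open>M - m \<longlonglongrightarrow> 0\<close> at a uniform exponential rate along the iterates
  \<open>u\<close> and \<open>v\<close> of \<open>\<L>\<^sub>x 1\<close> and \<open>1\<close>, and \<open>exp \<Phi>\<^sub>n\<close> is a quotient of integrals
  of \<open>u\<close> and \<open>v\<close>, so it lies in \<open>[m, M]\<close> whatever the measure.\<close>

section \<open>Lifting paths through maps of constant degree\<close>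

text \<open>The \<open>d\<close> preimages of \<open>y\<close> have disjoint neighbourhoods on which
  \<open>p\<close> is injective with Lipschitz inverse. Over the intersection \<open>W\<close> of
  their images every point has one preimage in each of them, and constancy of the degree excludes
  any others. So \<open>W\<close> is evenly covered; counting replaces a compactness
  argument.\<close>

lemma local_sections:
  fixes p :: "'b::metric_space \<Rightarrow> 'c::metric_space"
  assumes opn: "\<And>V. open V \<Longrightarrow> open (p ` V)"
    and exp: "\<And>z. \<exists>U K. open U \<and> z \<in> U \<and> (\<forall>w\<in>U. \<forall>w'\<in>U. dist w w' \<le> K * dist (p w) (p w'))"
    and fin: "\<And>y. finite {z. p z = y}" and deg: "\<And>y. card {z. p z = y} = d"
  obtains W where "open W" "y \<in> W"
    "\<forall>z. p z \<in> W \<longrightarrow> (\<exists>s. continuous_on W s \<and> s (p z) = z \<and> (\<forall>v\<in>W. p (s v) = v))"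
proof -
  define A where "A = {z. p z = y}"
  have finA: "finite A" using fin by (simp add: A_def)
  have "\<exists>e>0. \<forall>b\<in>A. b \<noteq> a \<longrightarrow> e \<le> dist a b" for a
    by (rule finite_set_avoid[OF finA])
  then obtain e where e: "\<And>a. e a > 0" "\<And>a b. b \<in> A \<Longrightarrow> b \<noteq> a \<Longrightarrow> e a \<le> dist a b"
    by metis
  \<comment> \<open>Radii of at most half the distance to the other preimages make these
    neighbourhoods disjoint.\<close>
  have "\<exists>V K. open V \<and> a \<in> V \<and> V \<subseteq> ball a (e a / 2) \<and> (\<forall>w\<in>V. \<forall>w'\<in>V. dist w w' \<le> K * dist (p w) (p w'))" for a
  proof -
    obtain U K where "open U" "a \<in> U" "\<forall>w\<in>U. \<forall>w'\<in>U. dist w w' \<le> K * dist (p w) (p w')"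
      using exp[of a] by blast
    then show ?thesis using e(1) by (intro exI[of _ "U \<inter> ball a (e a / 2)"] exI[of _ K]) auto
  qed
  then obtain V K where "\<And>a. open (V a) \<and> a \<in> V a \<and> V a \<subseteq> ball a (e a / 2) \<and>
      (\<forall>w\<in>V a. \<forall>w'\<in>V a. dist w w' \<le> K a * dist (p w) (p w'))"
    by metis
  then have V: "\<And>a. open (V a)" "\<And>a. a \<in> V a" "\<And>a. V a \<subseteq> ball a (e a / 2)"
      "\<And>a w w'. w \<in> V a \<Longrightarrow> w' \<in> V a \<Longrightarrow> dist w w' \<le> K a * dist (p w) (p w')"
    by blast+
  have disj: "a = b" if "a \<in> A" "b \<in> A" "w \<in> V a" "w \<in> V b" for a b w
  proof (rule ccontr)
    assume "a \<noteq> b"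
    then have "e a \<le> dist a b" "e b \<le> dist a b"
      using e(2)[of b a] e(2)[of a b] that by (auto simp: dist_commute)
    moreover have "dist a w < e a / 2" "dist b w < e b / 2"
      using V(3)[of a] V(3)[of b] that by auto
    moreover have "dist a b \<le> dist a w + dist b w" by (rule dist_triangle2)
    ultimately show False by linarith
  qed
  define W where "W = (\<Inter>a\<in>A. p ` V a)"
  have "open W" unfolding W_def using finA opn V(1) by auto
  moreover have "y \<in> W" unfolding W_def using V(2) by (auto simp: A_def)
  moreover have "\<exists>s. continuous_on W s \<and> s (p z) = z \<and> (\<forall>v\<in>W. p (s v) = v)" if "p z \<in> W" for z
  proof -
    define s where "s a = inv_into (V a) p" for a
    have s: "s a v \<in> V a" "p (s a v) = v" if "a \<in> A" "v \<in> W" for a v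
      using that by (auto simp: s_def W_def intro: inv_into_into f_inv_into_f)
    have inj: "inj_on (\<lambda>a. s a (p z)) A"
    proof (rule inj_onI)
      fix a b assume ab: "a \<in> A" "b \<in> A" and "s a (p z) = s b (p z)"
      then have "s a (p z) \<in> V b" using s(1)[OF ab(2) that] by simp
      then show "a = b" using disj ab s(1)[OF ab(1) that] by blast
    qed
    \<comment> \<open>The \<open>d\<close> sections take distinct values over \<open>p z\<close>, so
      they exhaust its \<open>d\<close> preimages, and \<open>z\<close> is one of these
      values.\<close>
    have "(\<lambda>a. s a (p z)) ` A = {w. p w = p z}"
    proof (rule card_subset_eq)
      show "card ((\<lambda>a. s a (p z)) ` A) = card {w. p w = p z}"
        using card_image[OF inj] deg by (simp add: A_def)
    qed (use fin s that in auto)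
    then have "z \<in> (\<lambda>a. s a (p z)) ` A" by simp
    then obtain a where a: "a \<in> A" "s a (p z) = z" by auto
    have "continuous_on W (s a)"
    proof (rule continuous_on_iff[THEN iffD2], intro ballI allI impI)
      fix v r assume v: "v \<in> W" "(0::real) < r"
      \<comment> \<open>The sign of \<open>K a\<close> is not known, so
        \<open>\<bar>K a\<bar> + 1\<close> serves as a positive Lipschitz constant.\<close>
      have "dist (s a v') (s a v) < r" if "v' \<in> W" "dist v' v < r / (\<bar>K a\<bar> + 1)" for v'
      proof -
        have "dist (s a v') (s a v) \<le> K a * dist v' v"
          using V(4)[of "s a v'" a "s a v"] s[OF a(1)] that v by simp
        also have "\<dots> \<le> (\<bar>K a\<bar> + 1) * dist v' v"
          by (intro mult_right_mono) auto
        also have "\<dots> < r" using that(2) by (simp add: field_simps)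
        finally show ?thesis .
      qed
      then show "\<exists>\<delta>>0. \<forall>v'\<in>W. dist v' v < \<delta> \<longrightarrow> dist (s a v') (s a v) < r"
        using v by (intro exI[of _ "r / (\<bar>K a\<bar> + 1)"]) auto
    qed
    then show ?thesis using a s(2)[OF a(1)] by (intro exI[of _ "s a"]) simp
  qed
  ultimately show ?thesis using that by blast
qed

text \<open>Bisection of the interval: liftability of \<open>c\<close> on \<open>{u..v}\<close> is
  stable under concatenation, and it holds on short intervals by composing \<open>c\<close> with a
  local section.\<close>

lemma path_lifting:
  fixes p :: "'b::metric_space \<Rightarrow> 'c::metric_space" and c :: "real \<Rightarrow> 'c"
  assumes opn: "\<And>V. open V \<Longrightarrow> open (p ` V)"
    and exp: "\<And>z. \<exists>U K. open U \<and> z \<in> U \<and> (\<forall>w\<in>U. \<forall>w'\<in>U. dist w w' \<le> K * dist (p w) (p w'))"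
    and fin: "\<And>y. finite {z. p z = y}" and deg: "\<And>y. card {z. p z = y} = d"
    and c: "continuous_on {a..b} c" and "a \<le> b" and z: "p z = c a"
  obtains h where "continuous_on {a..b} h" "h a = z" "\<And>t. t \<in> {a..b} \<Longrightarrow> p (h t) = c t"
proof -
  \<comment> \<open>Quantifying over all starting points \<open>z\<close> lets a second lift start
    where the first one ends.\<close>
  define P where "P u v \<longleftrightarrow> (a \<le> u \<and> u \<le> v \<and> v \<le> b \<longrightarrow> (\<forall>z. p z = c u \<longrightarrow>
    (\<exists>h. continuous_on {u..v} h \<and> h u = z \<and> (\<forall>t\<in>{u..v}. p (h t) = c t))))" for u v
  have "P a b"
  proof (rule Bolzano[OF \<open>a \<le> b\<close>])
    fix u v w assume "P u v" "P v w" "u \<le> v" "v \<le> w"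
    show "P u w"
      unfolding P_def
    proof (intro impI allI)
      fix z assume uw: "a \<le> u \<and> u \<le> w \<and> w \<le> b" and z: "p z = c u"
      obtain h1 where h1: "continuous_on {u..v} h1" "h1 u = z" "\<forall>t\<in>{u..v}. p (h1 t) = c t"
        using \<open>P u v\<close> uw z \<open>u \<le> v\<close> \<open>v \<le> w\<close> unfolding P_def by force
      then have "p (h1 v) = c v" using \<open>u \<le> v\<close> by auto
      then obtain h2 where h2: "continuous_on {v..w} h2" "h2 v = h1 v" "\<forall>t\<in>{v..w}. p (h2 t) = c t"
        using \<open>P v w\<close> uw \<open>u \<le> v\<close> \<open>v \<le> w\<close> unfolding P_def by force
      have "continuous_on {t \<in> {u..w}. t \<le> v} h1" "continuous_on {t \<in> {u..w}. v \<le> t} h2"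
        by (auto intro: continuous_on_subset[OF h1(1)] continuous_on_subset[OF h2(1)])
      then have "continuous_on {u..w} (\<lambda>t. if t \<le> v then h1 t else h2 t)"
        using h2(2) by (intro continuous_on_cases_le) auto
      then show "\<exists>h. continuous_on {u..w} h \<and> h u = z \<and> (\<forall>t\<in>{u..w}. p (h t) = c t)"
        using h1 h2 \<open>u \<le> v\<close> by (intro exI[of _ "\<lambda>t. if t \<le> v then h1 t else h2 t"]) auto
    qed
  next
    fix x assume x: "a \<le> x" "x \<le> b"
    obtain W where W: "open W" "c x \<in> W"
      "\<forall>z. p z \<in> W \<longrightarrow> (\<exists>s. continuous_on W s \<and> s (p z) = z \<and> (\<forall>v\<in>W. p (s v) = v))"
      by (rule local_sections[where y = "c x", OF opn exp fin deg])
    obtain r where r: "r > 0" "ball (c x) r \<subseteq> W" using W openE by blast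
    obtain \<delta> where \<delta>: "\<delta> > 0" "\<And>t. t \<in> {a..b} \<Longrightarrow> dist t x < \<delta> \<Longrightarrow> dist (c t) (c x) < r"
      using c x r(1) unfolding continuous_on_iff by (metis atLeastAtMost_iff)
    have "P u v" if uv: "u \<le> x" "x \<le> v" "v - u < \<delta>" for u v
      unfolding P_def
    proof (intro impI allI)
      fix z assume uv': "a \<le> u \<and> u \<le> v \<and> v \<le> b" and z: "p z = c u"
      have cW: "c t \<in> W" if "t \<in> {u..v}" for t
      proof -
        have "dist (c t) (c x) < r"
          using that uv uv' by (intro \<delta>(2)) (auto simp: dist_real_def)
        then show ?thesis using r(2) by (auto simp: dist_commute)
      qed
      then have "p z \<in> W" using z uv by simp
      from W(3)[rule_format, OF this]
      obtain s where s: "continuous_on W s" "s (p z) = z" "\<forall>v\<in>W. p (s v) = v"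
        by auto
      have "continuous_on {u..v} (\<lambda>t. s (c t))"
        by (rule continuous_on_compose2[OF s(1) continuous_on_subset[OF c]]) (use uv' cW in auto)
      then show "\<exists>h. continuous_on {u..v} h \<and> h u = z \<and> (\<forall>t\<in>{u..v}. p (h t) = c t)"
        using s z cW by (intro exI[of _ "\<lambda>t. s (c t)"] conjI ballI) simp_all
    qed
    then show "\<exists>\<delta>>0. \<forall>u v. u \<le> x \<and> x \<le> v \<and> v - u < \<delta> \<longrightarrow> P u v"
      using \<delta>(1) by (intro exI[of _ \<delta>]) simp
  qed
  then obtain h where "continuous_on {a..b} h" "h a = z" "\<forall>t\<in>{a..b}. p (h t) = c t"
    using z \<open>a \<le> b\<close> unfolding P_def by auto
  then show ?thesis using that by simp
qed

text \<open>The times at which two lifts agree form a set that is closed by continuity and open by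
  local injectivity of \<open>p\<close>; an interval is connected.\<close>

lemma lift_unique:
  fixes p :: "'b::metric_space \<Rightarrow> 'c::metric_space" and h1 h2 :: "real \<Rightarrow> 'b"
  assumes inj: "\<And>z. \<exists>U. open U \<and> z \<in> U \<and> inj_on p U"
    and h: "continuous_on {a..b} h1" "continuous_on {a..b} h2"
      "\<And>t. t \<in> {a..b} \<Longrightarrow> p (h1 t) = p (h2 t)"
    and t: "t \<in> {a..b}" "h1 t = h2 t" and u: "u \<in> {a..b}"
  shows "h1 u = h2 u"
proof -
  define S where "S = {t \<in> {a..b}. dist (h1 t) (h2 t) = 0}"
  have "closedin (top_of_set {a..b}) S"
    unfolding S_def by (rule continuous_closedin_preimage_constant[OF continuous_on_dist[OF h(1,2)]])
  moreover have "openin (top_of_set {a..b}) S"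
  proof (subst openin_subopen, intro ballI)
    fix t assume tS: "t \<in> S"
    then have t: "t \<in> {a..b}" "h1 t = h2 t" by (auto simp: S_def)
    obtain U where U: "open U" "h1 t \<in> U" "inj_on p U" using inj[of "h1 t"] by auto
    let ?T = "({a..b} \<inter> h1 -` U) \<inter> ({a..b} \<inter> h2 -` U)"
    have T1: "openin (top_of_set {a..b}) ?T"
      by (rule openin_Int; rule continuous_openin_preimage_gen[OF _ U(1)]; rule h)
    have T2: "t \<in> ?T" using t U(2) by simp
    have T3: "?T \<subseteq> S"
    proof
      fix r assume "r \<in> ?T"
      then have r: "r \<in> {a..b}" "h1 r \<in> U" "h2 r \<in> U" by auto
      then have "h1 r = h2 r" using inj_onD[OF U(3) h(3)] by blast
      then show "r \<in> S" using r(1) by (simp add: S_def)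
    qed
    show "\<exists>T. openin (top_of_set {a..b}) T \<and> t \<in> T \<and> T \<subseteq> S"
      by (rule exI[of _ ?T], rule conjI[OF T1 conjI[OF T2 T3]])
  qed
  ultimately have "S = {} \<or> S = {a..b}"
    by (intro connected_Icc[of a b, unfolded connected_clopen, rule_format, of S] conjI)
  moreover have "t \<in> S" using t by (simp add: S_def)
  ultimately have "u \<in> S" using u by auto
  then show ?thesis by (simp add: S_def)
qed

text \<open>The projected curve has unit speed, so on short pieces the local bound reads
  \<open>K * (v - u)\<close>. Such bounds add up by the triangle inequality, and bisection reaches
  the whole interval.\<close>

lemma lift_endpoints_dist:
  fixes p :: "'b::metric_space \<Rightarrow> 'c::metric_space" and h :: "real \<Rightarrow> 'b"
  assumes h: "continuous_on {a..b} h" "a \<le> b"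
    and iso: "\<And>s t. s \<in> {a..b} \<Longrightarrow> t \<in> {a..b} \<Longrightarrow> dist (p (h s)) (p (h t)) = \<bar>s - t\<bar>"
    and K: "\<And>t. t \<in> {a..b} \<Longrightarrow> \<exists>U. open U \<and> h t \<in> U \<and>
        (\<forall>w\<in>U. \<forall>w'\<in>U. dist w w' \<le> K * dist (p w) (p w'))"
  shows "dist (h a) (h b) \<le> K * (b - a)"
proof -
  define P where "P u v \<longleftrightarrow> (a \<le> u \<and> u \<le> v \<and> v \<le> b \<longrightarrow> dist (h u) (h v) \<le> K * (v - u))" for u v
  have "P a b"
  proof (rule Bolzano[OF \<open>a \<le> b\<close>])
    fix u v w assume uvw: "P u v" "P v w" "u \<le> v" "v \<le> w"
    show "P u w"
      unfolding P_def
    proof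
      assume "a \<le> u \<and> u \<le> w \<and> w \<le> b"
      then have "dist (h u) (h v) \<le> K * (v - u)" "dist (h v) (h w) \<le> K * (w - v)"
        using uvw by (auto simp: P_def)
      then show "dist (h u) (h w) \<le> K * (w - u)"
        using dist_triangle[of "h u" "h w" "h v"] by (simp add: algebra_simps)
    qed
  next
    fix x assume x: "a \<le> x" "x \<le> b"
    then obtain U where U: "open U" "h x \<in> U" "\<forall>w\<in>U. \<forall>w'\<in>U. dist w w' \<le> K * dist (p w) (p w')"
      using K by force
    obtain r where r: "r > 0" "ball (h x) r \<subseteq> U" using U openE by blast
    obtain \<delta> where \<delta>: "\<delta> > 0" "\<And>t. t \<in> {a..b} \<Longrightarrow> dist t x < \<delta> \<Longrightarrow> dist (h t) (h x) < r"
      using h x r(1) unfolding continuous_on_iff by (metis atLeastAtMost_iff)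
    have "P u v" if uv: "u \<le> x" "x \<le> v" "v - u < \<delta>" for u v
      unfolding P_def
    proof
      assume uv': "a \<le> u \<and> u \<le> v \<and> v \<le> b"
      have "dist (h u) (h x) < r" "dist (h v) (h x) < r"
        using uv uv' by (auto intro!: \<delta>(2) simp: dist_real_def)
      then have "h u \<in> U" "h v \<in> U" using r(2) by (auto simp: dist_commute)
      then have "dist (h u) (h v) \<le> K * dist (p (h u)) (p (h v))" using U by blast
      also have "dist (p (h u)) (p (h v)) = v - u" using iso[of u v] uv' by auto
      finally show "dist (h u) (h v) \<le> K * (v - u)" .
    qed
    then show "\<exists>\<delta>>0. \<forall>u v. u \<le> x \<and> x \<le> v \<and> v - u < \<delta> \<longrightarrow> P u v"
      using \<delta>(1) by (intro exI[of _ \<delta>]) simp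
  qed
  then show ?thesis using \<open>a \<le> b\<close> by (auto simp: P_def)
qed

section \<open>Cones of Hoelder functions\<close>

text \<open>Letting \<open>z\<close> range over all points replaces the infimum of \<psi>. The
  condition becomes a family of homogeneous linear inequalities, which is what makes the cone
  arguments direct.\<close>

definition hcone :: "real \<Rightarrow> real \<Rightarrow> ('b::metric_space \<Rightarrow> real) \<Rightarrow> bool" where
  "hcone \<alpha> \<kappa> \<psi> \<longleftrightarrow> (\<forall>y. 0 \<le> \<psi> y) \<and> (\<forall>y y' z. \<bar>\<psi> y - \<psi> y'\<bar> \<le> \<kappa> * \<psi> z * dist y y' powr \<alpha>)"

lemma hcone_nonneg: "hcone \<alpha> \<kappa> \<psi> \<Longrightarrow> 0 \<le> \<psi> y"
  by (auto simp: hcone_def)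

lemma hcone_holder: "hcone \<alpha> \<kappa> \<psi> \<Longrightarrow> \<bar>\<psi> y - \<psi> y'\<bar> \<le> \<kappa> * \<psi> z * dist y y' powr \<alpha>"
  by (auto simp: hcone_def)

lemma hcone_mono:
  fixes \<psi> :: "'b::metric_space \<Rightarrow> real"
  assumes "hcone \<alpha> \<kappa> \<psi>" "\<kappa> \<le> \<kappa>'"
  shows "hcone \<alpha> \<kappa>' \<psi>"
  unfolding hcone_def
proof (intro conjI allI)
  fix y y' z :: 'b
  have "\<kappa> * \<psi> z * dist y y' powr \<alpha> \<le> \<kappa>' * \<psi> z * dist y y' powr \<alpha>"
    using assms by (intro mult_right_mono) (auto simp: hcone_def)
  then show "\<bar>\<psi> y - \<psi> y'\<bar> \<le> \<kappa>' * \<psi> z * dist y y' powr \<alpha>"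
    using hcone_holder[OF assms(1), of y y' z] by linarith
qed (use assms in \<open>auto simp: hcone_def\<close>)

lemma hcone_const: "0 \<le> a \<Longrightarrow> 0 \<le> \<kappa> \<Longrightarrow> hcone \<alpha> \<kappa> (\<lambda>_. a)"
  by (auto simp: hcone_def)

text \<open>A Harnack-type comparison: the cone inequality with \<open>z\<close> itself as the
  reference point.\<close>

lemma hcone_le:
  fixes \<psi> :: "'b::metric_space \<Rightarrow> real"
  assumes "hcone \<alpha> \<kappa> \<psi>" "0 \<le> \<kappa>" "0 \<le> \<alpha>" "\<And>y y' :: 'b. dist y y' \<le> D"
  shows "\<psi> y \<le> (1 + \<kappa> * D powr \<alpha>) * \<psi> z"
proof -
  have "\<psi> y - \<psi> z \<le> \<kappa> * \<psi> z * dist y z powr \<alpha>"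
    using hcone_holder[OF assms(1), of y z z] by linarith
  also have "\<dots> \<le> \<kappa> * \<psi> z * D powr \<alpha>"
    using assms by (intro mult_left_mono powr_mono2) (auto simp: hcone_def)
  finally show ?thesis by (simp add: algebra_simps)
qed

lemma hcone_continuous:
  fixes \<psi> :: "'b::metric_space \<Rightarrow> real"
  assumes "hcone \<alpha> \<kappa> \<psi>" "0 < \<alpha>"
  shows "continuous_on UNIV \<psi>"
proof -
  have "(\<psi> \<longlongrightarrow> \<psi> y) (at y)" for y :: 'b
  proof (rule Lim_transform_bound[where g = "\<lambda>y'. \<kappa> * \<psi> y * dist y' y powr \<alpha>", THEN LIM_zero_cancel])
    show "\<forall>\<^sub>F y' in at y. norm (\<psi> y' - \<psi> y) \<le> norm (\<kappa> * \<psi> y * dist y' y powr \<alpha>)"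
      using hcone_holder[OF assms(1)] by (intro always_eventually allI) (auto intro: order_trans[OF _ abs_ge_self])
    have "((\<lambda>y'. \<kappa> * \<psi> y * dist y' y powr \<alpha>) \<longlongrightarrow> \<kappa> * \<psi> y * 0 powr \<alpha>) (at y)"
    proof (intro tendsto_intros tendsto_powr')
      show "((\<lambda>y'. dist y' y) \<longlongrightarrow> 0) (at y)"
        by (rule tendsto_eq_intros refl | simp)+
    qed (use assms(2) in auto)
    then show "((\<lambda>y'. \<kappa> * \<psi> y * dist y' y powr \<alpha>) \<longlongrightarrow> 0) (at y)" by simp
  qed
  then show ?thesis by (simp add: continuous_on_def)
qed

text \<open>A hands-on version of the fact that a narrower cone has finite projective diameter
  in a wider one: a definite proportion of \<^term>\<open>v\<close>, measured at the base point \<^term>\<open>y0\<close>,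
  can be removed from \<^term>\<open>w\<close>.\<close>
lemma hcone_subtract:
  fixes w v :: "'b::metric_space \<Rightarrow> real"
  assumes w: "hcone \<alpha> \<kappa>' w" and v: "hcone \<alpha> \<kappa>' v" "\<And>y. 0 < v y"
    and \<kappa>: "0 < \<kappa>'" "\<kappa>' < \<kappa>" and \<alpha>: "0 \<le> \<alpha>" and D: "\<And>y y' :: 'b. dist y y' \<le> D"
  defines "c \<equiv> (\<kappa> - \<kappa>') / ((\<kappa> + \<kappa>') * (1 + \<kappa>' * D powr \<alpha>)\<^sup>2)"
  shows "hcone \<alpha> \<kappa> (\<lambda>y. w y - c * w y0 / v y0 * v y)"
proof -
  define B where "B = 1 + \<kappa>' * D powr \<alpha>"
  define \<delta> where "\<delta> = c * w y0 / v y0"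
  have B: "1 \<le> B" using \<kappa> by (simp add: B_def)
  have c: "0 \<le> c" using \<kappa> B by (simp add: c_def B_def)
  have \<delta>: "0 \<le> \<delta>" using c v(2) hcone_nonneg[OF w] by (simp add: \<delta>_def less_imp_le)
  \<comment> \<open>This is exactly what the new Hoelder bound requires, and it also gives
    nonnegativity because \<open>\<kappa> - \<kappa>' \<le> \<kappa> + \<kappa>'\<close>. The
    constant \<open>c\<close> is made for it: \<open>v\<close> and \<open>w\<close> each cost one
    factor \<open>B\<close> when moving between \<open>z\<close> and \<open>y0\<close>.\<close>
  have key: "\<delta> * (\<kappa> + \<kappa>') * v z \<le> (\<kappa> - \<kappa>') * w z" for z
  proof -
    have vz: "v z \<le> B * v y0" and wz: "w y0 \<le> B * w z"
      unfolding B_def using \<kappa> \<alpha> D by (auto intro!: hcone_le[OF v(1)] hcone_le[OF w])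
    have "\<delta> * (\<kappa> + \<kappa>') * v z \<le> \<delta> * (\<kappa> + \<kappa>') * (B * v y0)"
      using \<delta> \<kappa> vz by (intro mult_left_mono) auto
    also have "\<dots> = c * (\<kappa> + \<kappa>') * B * w y0"
      using v(2)[of y0] by (simp add: \<delta>_def)
    also have "\<dots> \<le> c * (\<kappa> + \<kappa>') * B * (B * w z)"
      using c \<kappa> B wz by (intro mult_left_mono) auto
    also have "\<dots> = (c * ((\<kappa> + \<kappa>') * B\<^sup>2)) * w z" by (simp add: power2_eq_square)
    also have "c * ((\<kappa> + \<kappa>') * B\<^sup>2) = \<kappa> - \<kappa>'"
      unfolding c_def B_def[symmetric] using \<kappa> B by simp
    finally show ?thesis .
  qed
  have "hcone \<alpha> \<kappa> (\<lambda>y. w y - \<delta> * v y)"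
    unfolding hcone_def
  proof (intro conjI allI)
    fix y :: 'b
    have "\<delta> * (\<kappa> + \<kappa>') * v y \<le> (\<kappa> + \<kappa>') * w y"
      using key[of y] mult_right_mono[of "\<kappa> - \<kappa>'" "\<kappa> + \<kappa>'" "w y"] \<kappa> hcone_nonneg[OF w, of y] by linarith
    then have "(\<kappa> + \<kappa>') * (\<delta> * v y) \<le> (\<kappa> + \<kappa>') * w y" by (simp add: mult_ac)
    then show "0 \<le> w y - \<delta> * v y" using \<kappa> by simp
  next
    fix y y' z :: 'b
    have "\<bar>(w y - \<delta> * v y) - (w y' - \<delta> * v y')\<bar> = \<bar>(w y - w y') - \<delta> * (v y - v y')\<bar>"
      by (simp add: algebra_simps)
    also have "\<dots> \<le> \<bar>w y - w y'\<bar> + \<delta> * \<bar>v y - v y'\<bar>"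
      using \<delta> abs_triangle_ineq4[of "w y - w y'" "\<delta> * (v y - v y')"] by (simp add: abs_mult)
    also have "\<dots> \<le> \<kappa>' * w z * dist y y' powr \<alpha> + \<delta> * (\<kappa>' * v z * dist y y' powr \<alpha>)"
      by (intro add_mono mult_left_mono hcone_holder w v \<delta>)
    also have "\<dots> = (\<kappa>' * w z + \<delta> * \<kappa>' * v z) * dist y y' powr \<alpha>" by (simp add: algebra_simps)
    also have "\<dots> \<le> \<kappa> * (w z - \<delta> * v z) * dist y y' powr \<alpha>"
      using key[of z] by (intro mult_right_mono) (auto simp: algebra_simps)
    finally show "\<bar>(w y - \<delta> * v y) - (w y' - \<delta> * v y')\<bar> \<le> \<kappa> * (w z - \<delta> * v z) * dist y y' powr \<alpha>" .
  qed
  then show ?thesis by (simp add: \<delta>_def)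
qed

text \<open>One Birkhoff step. \<open>T\<close> sends both gaps \<open>M v - u\<close> and
  \<open>u - m v\<close> into the narrower cone, so \<open>hcone_subtract\<close> can take from each
  the proportion \<open>c\<close> of its value at a base point, as a multiple of \<open>T v\<close>.
  The images of the gaps add up to \<open>(M - m) T v\<close>, hence the total loss is
  \<open>c * (M - m)\<close>.\<close>

lemma hcone_gap_contraction:
  fixes T :: "('b::metric_space \<Rightarrow> real) \<Rightarrow> 'b \<Rightarrow> real"
  assumes lin: "\<And>a b u v. T (\<lambda>y. a * u y + b * v y) = (\<lambda>y. a * T u y + b * T v y)"
    and T: "\<And>\<psi>. hcone \<alpha> \<kappa> \<psi> \<Longrightarrow> hcone \<alpha> \<kappa>' (T \<psi>)"
    and v: "hcone \<alpha> \<kappa> v" "\<And>y. 0 < T v y"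
    and M: "hcone \<alpha> \<kappa> (\<lambda>y. M * v y - u y)" and m: "hcone \<alpha> \<kappa> (\<lambda>y. u y - m * v y)"
    and \<kappa>: "0 < \<kappa>'" "\<kappa>' < \<kappa>" and \<alpha>: "0 \<le> \<alpha>" and D: "\<And>y y' :: 'b. dist y y' \<le> D"
  defines "c \<equiv> (\<kappa> - \<kappa>') / ((\<kappa> + \<kappa>') * (1 + \<kappa>' * D powr \<alpha>)\<^sup>2)"
  obtains M' m' where "hcone \<alpha> \<kappa> (\<lambda>y. M' * T v y - T u y)" "hcone \<alpha> \<kappa> (\<lambda>y. T u y - m' * T v y)"
    "m \<le> m'" "M' \<le> M" "M' - m' = (1 - c) * (M - m)"
proof -
  \<comment> \<open>The base point is arbitrary, but common to both gaps so that their values there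
    add up.\<close>
  define y0 :: 'b where "y0 = undefined"
  define w1 where "w1 = (\<lambda>y. M * T v y - T u y)"
  define w2 where "w2 = (\<lambda>y. T u y - m * T v y)"
  have "T (\<lambda>y. M * v y - u y) = w1" using lin[of M v "-1" u] by (simp add: w1_def)
  then have w1: "hcone \<alpha> \<kappa>' w1" using T[OF M] by simp
  have "T (\<lambda>y. u y - m * v y) = w2" using lin[of 1 u "-m" v] by (simp add: w2_def)
  then have w2: "hcone \<alpha> \<kappa>' w2" using T[OF m] by simp
  define M' where "M' = M - c * w1 y0 / T v y0"
  define m' where "m' = m + c * w2 y0 / T v y0"
  have c: "0 \<le> c" using \<kappa> by (simp add: c_def)
  have "hcone \<alpha> \<kappa> (\<lambda>y. w1 y - c * w1 y0 / T v y0 * T v y)"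
    unfolding c_def by (rule hcone_subtract[OF w1 T[OF v(1)] v(2) \<kappa> \<alpha> D])
  moreover have "(\<lambda>y. w1 y - c * w1 y0 / T v y0 * T v y) = (\<lambda>y. M' * T v y - T u y)"
    by (simp add: w1_def M'_def algebra_simps)
  moreover have "hcone \<alpha> \<kappa> (\<lambda>y. w2 y - c * w2 y0 / T v y0 * T v y)"
    unfolding c_def by (rule hcone_subtract[OF w2 T[OF v(1)] v(2) \<kappa> \<alpha> D])
  moreover have "(\<lambda>y. w2 y - c * w2 y0 / T v y0 * T v y) = (\<lambda>y. T u y - m' * T v y)"
    by (simp add: w2_def m'_def algebra_simps)
  moreover have "m \<le> m'" "M' \<le> M"
    using c v(2)[of y0] hcone_nonneg[OF w1, of y0] hcone_nonneg[OF w2, of y0] by (auto simp: m'_def M'_def)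
  moreover have "M' - m' = (1 - c) * (M - m)"
  proof -
    have "M' - m' = M - m - c * (w1 y0 + w2 y0) / T v y0"
      by (simp add: M'_def m'_def add_divide_distrib algebra_simps)
    also have "w1 y0 + w2 y0 = (M - m) * T v y0" by (simp add: w1_def w2_def algebra_simps)
    also have "c * ((M - m) * T v y0) / T v y0 = c * (M - m)" using v(2)[of y0] by simp
    finally show ?thesis by (simp add: algebra_simps)
  qed
  ultimately show ?thesis using that by simp
qed

text \<open>The constants reached after \<open>k\<close> steps stay valid: the later operators
  preserve the wider cone, so one pair \<open>M'\<close>, \<open>m'\<close> bounds the quotients for
  every \<open>n \<ge> k\<close>. This permits comparing two different times. The clause
  \<open>m \<le> m'\<close> keeps the lower constant from dropping.\<close>

lemma hcone_gap_iterate: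
  fixes T :: "nat \<Rightarrow> ('b::metric_space \<Rightarrow> real) \<Rightarrow> 'b \<Rightarrow> real"
  assumes lin: "\<And>n a b u v. T n (\<lambda>y. a * u y + b * v y) = (\<lambda>y. a * T n u y + b * T n v y)"
    and T: "\<And>n \<psi>. hcone \<alpha> \<kappa> \<psi> \<Longrightarrow> hcone \<alpha> \<kappa>' (T n \<psi>)"
    and u: "\<And>n. u (Suc n) = T n (u n)" and v: "\<And>n. v (Suc n) = T n (v n)"
    and v0: "hcone \<alpha> \<kappa> (v 0)" and vpos: "\<And>n y. 0 < v n y"
    and M: "hcone \<alpha> \<kappa> (\<lambda>y. M * v 0 y - u 0 y)" and m: "hcone \<alpha> \<kappa> (\<lambda>y. u 0 y - m * v 0 y)"
    and \<kappa>: "0 < \<kappa>'" "\<kappa>' < \<kappa>" and \<alpha>: "0 \<le> \<alpha>" and D: "\<And>y y' :: 'b. dist y y' \<le> D"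
  defines "c \<equiv> (\<kappa> - \<kappa>') / ((\<kappa> + \<kappa>') * (1 + \<kappa>' * D powr \<alpha>)\<^sup>2)"
  shows "\<exists>M' m'. m \<le> m' \<and> M' - m' = (1 - c) ^ k * (M - m) \<and>
    (\<forall>n\<ge>k. \<forall>y. m' * v n y \<le> u n y \<and> u n y \<le> M' * v n y)"
proof -
  have vc: "hcone \<alpha> \<kappa> (v n)" for n
  proof (induction n)
    case (Suc n)
    have "hcone \<alpha> \<kappa>' (v (Suc n))" using T[OF Suc] by (simp add: v)
    then show ?case using \<kappa> by (auto intro: hcone_mono)
  qed (rule v0)
  have "\<exists>M' m'. m \<le> m' \<and> M' - m' = (1 - c) ^ k * (M - m) \<and>
      hcone \<alpha> \<kappa> (\<lambda>y. M' * v k y - u k y) \<and> hcone \<alpha> \<kappa> (\<lambda>y. u k y - m' * v k y)"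
  proof (induction k)
    case 0
    then show ?case using M m by auto
  next
    case (Suc k)
    then obtain M1 m1 where 1: "m \<le> m1" "M1 - m1 = (1 - c) ^ k * (M - m)"
      "hcone \<alpha> \<kappa> (\<lambda>y. M1 * v k y - u k y)" "hcone \<alpha> \<kappa> (\<lambda>y. u k y - m1 * v k y)" by blast
    have Tv: "0 < T k (v k) y" for y using vpos[of "Suc k"] by (simp add: v)
    obtain M' m' where "hcone \<alpha> \<kappa> (\<lambda>y. M' * T k (v k) y - T k (u k) y)"
      "hcone \<alpha> \<kappa> (\<lambda>y. T k (u k) y - m' * T k (v k) y)" "m1 \<le> m'" "M' - m' = (1 - c) * (M1 - m1)"
      by (rule hcone_gap_contraction[where T = "T k" and u = "u k" and v = "v k" and D = D and
            M = M1 and m = m1 and \<kappa> = \<kappa> and \<kappa>' = \<kappa>' and \<alpha> = \<alpha>,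
            OF lin T vc Tv 1(3,4) \<kappa> \<alpha> D, folded c_def]) (use 1(2) in auto)
    then show ?case using 1 by (intro exI[of _ M'] exI[of _ m']) (auto simp: u v)
  qed
  then obtain M' m' where *: "m \<le> m'" "M' - m' = (1 - c) ^ k * (M - m)"
    "hcone \<alpha> \<kappa> (\<lambda>y. M' * v k y - u k y)" "hcone \<alpha> \<kappa> (\<lambda>y. u k y - m' * v k y)" by blast
  have "hcone \<alpha> \<kappa> (\<lambda>y. M' * v n y - u n y) \<and> hcone \<alpha> \<kappa> (\<lambda>y. u n y - m' * v n y)" if "k \<le> n" for n
    using that
  proof (induction n rule: dec_induct)
    case (step n)
    have "T n (\<lambda>y. M' * v n y - u n y) = (\<lambda>y. M' * v (Suc n) y - u (Suc n) y)"
      using lin[of n M' "v n" "-1" "u n"] by (simp add: u v)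
    moreover have "T n (\<lambda>y. u n y - m' * v n y) = (\<lambda>y. u (Suc n) y - m' * v (Suc n) y)"
      using lin[of n 1 "u n" "- m'" "v n"] by (simp add: u v)
    ultimately show ?case
      using T[OF step.IH[THEN conjunct1], of n] T[OF step.IH[THEN conjunct2], of n] \<kappa>(2)
      by (auto intro: hcone_mono[OF _ less_imp_le])
  qed (use * in auto)
  then have "\<forall>n\<ge>k. \<forall>y. m' * v n y \<le> u n y \<and> u n y \<le> M' * v n y"
    by (simp add: hcone_def)
  then show ?thesis using * by blast
qed

section \<open>Fibre maps and transfer operators\<close>

text \<open>Openness of the skew product passes to the slice over \<open>f x\<close>: an
  \<open>x'\<close> close to \<open>x\<close> with \<open>f x' = f x\<close> equals \<open>x\<close>
  by expansion, so near \<open>(x, y)\<close> only the fibre of \<open>x\<close> contributes to that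
  slice.\<close>

lemma fiber_map_open:
  fixes f :: "'a::metric_space \<Rightarrow> 'a" and g :: "'a \<Rightarrow> 'b::metric_space \<Rightarrow> 'b"
  assumes F: "local_homeo (skew f g)"
    and f: "1 < \<gamma>" "0 < \<delta>" "\<And>x x'. dist x x' \<le> \<delta> \<Longrightarrow> \<gamma> * dist x x' \<le> dist (f x) (f x')"
    and V: "open V"
  shows "open (g x ` V)"
proof (subst open_subopen, intro ballI)
  fix v assume "v \<in> g x ` V"
  then obtain y where y: "y \<in> V" "v = g x y" by auto
  obtain U where U: "open U" "(x, y) \<in> U" "open (skew f g ` U)"
    "homeomorphism U (skew f g ` U) (skew f g) (inv_into U (skew f g))"
    using F unfolding local_homeo_def by meson
  define S where "S = U \<inter> ball x \<delta> \<times> V"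
  have "open S" unfolding S_def by (intro open_Int open_Times U V open_ball)
  then have "openin (top_of_set U) S" by (simp add: open_subset S_def)
  then have "openin (top_of_set (skew f g ` U)) (skew f g ` S)"
    by (rule homeomorphism_imp_open_map[OF U(4)])
  then have opS: "open (skew f g ` S)" using U(3) openin_open_trans by blast
  define T where "T = Pair (f x) -` (skew f g ` S)"
  have T1: "open T" unfolding T_def by (intro open_vimage opS continuous_intros)
  have T2: "v \<in> T" using y U f(2) by (force simp: T_def S_def skew_def)
  have T3: "T \<subseteq> g x ` V"
  proof
    fix w assume "w \<in> T"
    then obtain x' y' where xy: "(x', y') \<in> S" "f x = f x'" "w = g x' y'"
      by (auto simp: T_def skew_def)
    have "dist x x' < \<delta>" using xy(1) by (auto simp: S_def)
    then have "\<gamma> * dist x x' \<le> 0" using f(3)[of x x'] xy(2) by simp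
    then have "x' = x" using f(1) by (simp add: mult_le_0_iff)
    then show "w \<in> g x ` V" using xy by (auto simp: S_def)
  qed
  show "\<exists>T. open T \<and> v \<in> T \<and> T \<subseteq> g x ` V"
    by (rule exI[of _ T], rule conjI[OF T1 conjI[OF T2 T3]])
qed

text \<open>On a fibre the base distances in \<open>pdist\<close> vanish. Relaxing \<open>K\<close>
  to \<open>K'\<close> lets one constant serve a whole lift, along which the local constants
  vary.\<close>

lemma fiber_map_locally_expanding:
  fixes f :: "'a::metric_space \<Rightarrow> 'a" and g :: "'a \<Rightarrow> 'b::metric_space \<Rightarrow> 'b"
  assumes "open U" "(x, y) \<in> U" "\<forall>w\<in>U. \<forall>w'\<in>U. pdist w w' \<le> K * pdist (skew f g w) (skew f g w')"
    and "K \<le> K'"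
  shows "\<exists>V. open V \<and> y \<in> V \<and> (\<forall>w\<in>V. \<forall>w'\<in>V. dist w w' \<le> K' * dist (g x w) (g x w'))"
proof -
  define V where "V = Pair x -` U"
  have 1: "open V" unfolding V_def by (intro open_vimage assms continuous_intros)
  have 2: "dist w w' \<le> K' * dist (g x w) (g x w')" if "w \<in> V" "w' \<in> V" for w w'
  proof -
    have "pdist (x, w) (x, w') \<le> K * pdist (skew f g (x, w)) (skew f g (x, w'))"
      using assms(3) that by (simp add: V_def)
    also have "\<dots> = K * dist (g x w) (g x w')" by (simp add: pdist_def skew_def)
    also have "\<dots> \<le> K' * dist (g x w) (g x w')" using assms(4) by (rule mult_right_mono) simp
    finally show ?thesis by (simp add: pdist_def)
  qed
  show ?thesis using 1 2 assms(2) by (intro exI[of _ V]) (simp add: V_def)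
qed

text \<open>The preimages of two points are matched by lifting a minimizing geodesic between them;
  the lifts are pairwise disjoint, so each element of the cover is charged by at most one of them.\<close>
lemma preimage_matching:
  fixes f :: "'a::metric_space \<Rightarrow> 'a" and g :: "'a \<Rightarrow> 'b::metric_space \<Rightarrow> 'b"
  assumes geo: "geodesic_space (dist :: 'b \<Rightarrow> 'b \<Rightarrow> real)"
    and F: "local_homeo (skew f g)"
    and f: "1 < \<gamma>" "0 < \<delta>" "\<And>x x'. dist x x' \<le> \<delta> \<Longrightarrow> \<gamma> * dist x x' \<le> dist (f x) (f x')"
    and deg: "\<And>x y. finite {y'. g x y' = y}" "\<And>x y. card {y'. g x y' = y} = d"
    and Lz: "\<And>z. \<exists>U. open U \<and> z \<in> U \<and> inj_on (skew f g) U \<and>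
         (\<forall>w\<in>U. \<forall>w'\<in>U. pdist w w' \<le> Lz z * pdist (skew f g w) (skew f g w'))"
    and L: "1 \<le> L" "\<And>z. z \<in> A \<Longrightarrow> Lz z \<le> L" "\<And>z. z \<notin> A \<Longrightarrow> Lz z < 1 / \<gamma>"
    and V: "finite V" "A \<subseteq> \<Union>V"
    and curves: "\<And>U l c c1 c2. U \<in> V \<Longrightarrow> min_geodesic pdist l c \<Longrightarrow>
        continuous_on {0..l} c1 \<Longrightarrow> (\<And>t. t \<in> {0..l} \<Longrightarrow> skew f g (c1 t) = c t) \<Longrightarrow> c1 ` {0..l} \<inter> U \<noteq> {} \<Longrightarrow>
        continuous_on {0..l} c2 \<Longrightarrow> (\<And>t. t \<in> {0..l} \<Longrightarrow> skew f g (c2 t) = c t) \<Longrightarrow> c2 ` {0..l} \<inter> U \<noteq> {} \<Longrightarrow>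
        c1 ` {0..l} = c2 ` {0..l}"
  obtains m B where "bij_betw m {a. g x a = y} {a. g x a = y'}" "B \<subseteq> {a. g x a = y}" "card B \<le> card V"
    "\<And>a. a \<in> B \<Longrightarrow> dist a (m a) \<le> L * dist y y'"
    "\<And>a. g x a = y \<Longrightarrow> a \<notin> B \<Longrightarrow> dist a (m a) \<le> 1 / \<gamma> * dist y y'"
proof -
  obtain l c where c: "min_geodesic dist l c" "c 0 = y" "c l = y'"
    using geo unfolding geodesic_space_def by blast
  then have l: "0 \<le> l" and cd: "\<And>s t. s \<in> {0..l} \<Longrightarrow> t \<in> {0..l} \<Longrightarrow> dist (c s) (c t) = \<bar>s - t\<bar>"
    by (auto simp: min_geodesic_def)
  have yl: "dist y y' = l" using cd[of 0 l] l c by simp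
  have cc: "continuous_on {0..l} c"
  proof (rule continuous_on_iff[THEN iffD2], intro ballI allI impI)
    fix s e assume "s \<in> {0..l}" "(0::real) < e"
    then show "\<exists>d>0. \<forall>t\<in>{0..l}. dist t s < d \<longrightarrow> dist (c t) (c s) < e"
      by (intro exI[of _ e]) (simp add: cd dist_real_def)
  qed
  have li: "\<exists>U K. open U \<and> z \<in> U \<and> (\<forall>w\<in>U. \<forall>w'\<in>U. dist w w' \<le> K * dist (g x w) (g x w'))" for z
  proof -
    obtain U where "open U" "(x, z) \<in> U"
      "\<forall>w\<in>U. \<forall>w'\<in>U. pdist w w' \<le> Lz (x, z) * pdist (skew f g w) (skew f g w')"
      using Lz[of "(x, z)"] by auto
    from fiber_map_locally_expanding[OF this order_refl] show ?thesis by auto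
  qed
  have inj: "\<exists>U. open U \<and> z \<in> U \<and> inj_on (g x) U" for z
  proof -
    obtain U K where U: "open U" "z \<in> U" "\<forall>w\<in>U. \<forall>w'\<in>U. dist w w' \<le> K * dist (g x w) (g x w')"
      using li[of z] by auto
    have "inj_on (g x) U" using U(3) by (force intro!: inj_onI)
    then show ?thesis using U by auto
  qed
  have "\<exists>h. continuous_on {0..l} h \<and> h 0 = a \<and> (\<forall>t\<in>{0..l}. g x (h t) = c t)" if a: "g x a = y" for a
  proof -
    obtain h where "continuous_on {0..l} h" "h 0 = a" "\<And>t. t \<in> {0..l} \<Longrightarrow> g x (h t) = c t"
      by (rule path_lifting[of "g x" d 0 l c a, OF fiber_map_open[OF F f] li deg cc l])
        (use a c in auto)
    then show ?thesis by auto
  qed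
  then obtain h where h: "\<And>a. g x a = y \<Longrightarrow> continuous_on {0..l} (h a)"
    "\<And>a. g x a = y \<Longrightarrow> h a 0 = a" "\<And>a t. g x a = y \<Longrightarrow> t \<in> {0..l} \<Longrightarrow> g x (h a t) = c t"
    by metis
  have h_inj: "a = b" if "g x a = y" "g x b = y" "t \<in> {0..l}" "h a t = h b t" for a b t
  proof -
    have "h a 0 = h b 0"
      by (rule lift_unique[where p = "g x" and a = 0 and b = l and t = t, OF inj]) (use h that l in auto)
    then show ?thesis using h(2) that by simp
  qed
  define m where "m a = h a l" for a
  \<comment> \<open>The exceptional preimages: their lifts enter \<open>A\<close> at some time,
    where only the weaker constant \<open>L\<close> is available.\<close>
  define B where "B = {a. g x a = y \<and> (\<exists>t\<in>{0..l}. (x, h a t) \<in> A)}"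
  have m_inj: "inj_on m {a. g x a = y}"
    by (rule inj_onI) (use h_inj[where t = l] l in \<open>auto simp: m_def\<close>)
  \<comment> \<open>Lifts with the same end point coincide, so \<open>m\<close> is injective; equal
    cardinality of the fibres makes it onto.\<close>
  moreover have "m ` {a. g x a = y} = {a. g x a = y'}"
  proof (rule card_subset_eq)
    show "m ` {a. g x a = y} \<subseteq> {a. g x a = y'}" using h(3)[where t = l] l c by (auto simp: m_def)
    show "card (m ` {a. g x a = y}) = card {a. g x a = y'}" using card_image[OF m_inj] deg by simp
  qed (rule deg)
  ultimately have bij: "bij_betw m {a. g x a = y} {a. g x a = y'}" by (simp add: bij_betw_def)
  have BA: "B \<subseteq> {a. g x a = y}" by (auto simp: B_def)
  have "\<exists>W\<in>V. (\<lambda>t. (x, h a t)) ` {0..l} \<inter> W \<noteq> {}" if aB: "a \<in> B" for a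
  proof -
    obtain t where t: "t \<in> {0..l}" "(x, h a t) \<in> A" using aB unfolding B_def by auto
    then obtain W where "W \<in> V" "(x, h a t) \<in> W" using V(2) by auto
    then have "(x, h a t) \<in> (\<lambda>t. (x, h a t)) ` {0..l} \<inter> W" using t(1) by simp
    then show ?thesis using \<open>W \<in> V\<close> by (intro bexI[of _ W]) (simp_all only: ex_in_conv[symmetric] exI)
  qed
  then obtain W where W: "\<And>a. a \<in> B \<Longrightarrow> W a \<in> V"
    "\<And>a. a \<in> B \<Longrightarrow> (\<lambda>t. (x, h a t)) ` {0..l} \<inter> W a \<noteq> {}"
    by metis
  \<comment> \<open>The first coordinate is constant, so in the sum metric the geodesic of the fibre
    stays minimizing in the product; the curves \<open>(x, h a t)\<close> are lifts of it.\<close>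
  have geo': "min_geodesic pdist l (\<lambda>t. (f x, c t))"
    using c(1) by (simp add: min_geodesic_def pdist_def)
  have "inj_on W B"
  proof (rule inj_onI)
    fix a b assume ab: "a \<in> B" "b \<in> B" "W a = W b"
    then have gab: "g x a = y" "g x b = y" using BA by auto
    have "(\<lambda>t. (x, h a t)) ` {0..l} = (\<lambda>t. (x, h b t)) ` {0..l}"
    proof (rule curves[OF W(1)[OF ab(1)] geo' _ _ W(2)[OF ab(1)]])
      show "(\<lambda>t. (x, h b t)) ` {0..l} \<inter> W a \<noteq> {}" unfolding ab(3) by (rule W(2)[OF ab(2)])
    qed (use h gab in \<open>auto simp: skew_def intro!: continuous_on_Pair continuous_on_const\<close>)
    moreover have "(x, h a 0) \<in> (\<lambda>t. (x, h a t)) ` {0..l}" using l by simp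
    ultimately obtain t where t: "t \<in> {0..l}" "h a 0 = h b t" by auto
    \<comment> \<open>Equality of the curves as sets only yields some time \<open>t\<close>;
      projecting by \<open>g x\<close> and injectivity of \<open>c\<close> give
      \<open>t = 0\<close>.\<close>
    have "c 0 = c t" using h(3)[OF gab(1), of 0] h(3)[OF gab(2) t(1)] t(2) l by simp
    then have "t = 0" using cd[of 0 t] t(1) l by simp
    then show "a = b" using h_inj[of a b 0] gab t l by simp
  qed
  then have cB: "card B \<le> card V" by (rule card_inj_on_le) (use W V in auto)
  have len: "dist a (m a) \<le> K * dist y y'" if a: "g x a = y" and K: "\<And>t. t \<in> {0..l} \<Longrightarrow> Lz (x, h a t) \<le> K" for a K
  proof -
    have "dist (h a 0) (h a l) \<le> K * (l - 0)"
    proof (rule lift_endpoints_dist[where p = "g x", OF h(1)[OF a] l])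
      fix t assume t: "t \<in> {0..l}"
      obtain U where "open U" "(x, h a t) \<in> U"
        "\<forall>w\<in>U. \<forall>w'\<in>U. pdist w w' \<le> Lz (x, h a t) * pdist (skew f g w) (skew f g w')"
        using Lz[of "(x, h a t)"] by auto
      from fiber_map_locally_expanding[OF this K[OF t]]
      show "\<exists>U. open U \<and> h a t \<in> U \<and> (\<forall>w\<in>U. \<forall>w'\<in>U. dist w w' \<le> K * dist (g x w) (g x w'))" .
    qed (use h(3) cd a in auto)
    then show ?thesis using h(2) a yl by (simp add: m_def)
  qed
  \<comment> \<open>Off \<open>A\<close> the local constant is below \<open>L\<close> as well, so an
    exceptional lift obeys the bound \<open>L\<close> along its whole course.\<close>
  have \<gamma>L: "1 / \<gamma> \<le> L" using f(1) L(1) by (simp add: field_simps) (use mult_mono[of 1 L 1 \<gamma>] in simp)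
  have LzL: "Lz z \<le> L" for z using L(2)[of z] L(3)[of z] \<gamma>L by fastforce
  show ?thesis
  proof (rule that[OF bij BA cB])
    fix a assume "a \<in> B"
    then have "g x a = y" using BA by auto
    then show "dist a (m a) \<le> L * dist y y'" using LzL by (rule len)
  next
    fix a assume a: "g x a = y" "a \<notin> B"
    show "dist a (m a) \<le> 1 / \<gamma> * dist y y'"
    proof (rule len[OF a(1)])
      fix t assume "t \<in> {0..l}"
      then have "(x, h a t) \<notin> A" using a by (auto simp: B_def)
      then show "Lz (x, h a t) \<le> 1 / \<gamma>" using L(3) by force
    qed
  qed
qed

lemma Lop_lin: "Lop g \<phi> x (\<lambda>y. a * u y + b * v y) = (\<lambda>y. a * Lop g \<phi> x u y + b * Lop g \<phi> x v y)"
  by (simp add: fun_eq_iff Lop_def sum_distrib_left sum.distrib[symmetric] algebra_simps)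

text \<open>Preimages are compared in matched pairs. Each difference splits into a variation of
  \<psi>, weighted by at most \<open>exp (i + \<epsilon>)\<close>, and a variation of the weight,
  controlled by \<open>\<epsilon> * exp i\<close>, times a value of \<psi>. Summing the powers of
  the pair distances gives \<open>R\<close>; the division by \<open>d\<close> comes from averaging
  over the preimages of the reference point.\<close>

lemma Lop_hcone:
  fixes g :: "'a::metric_space \<Rightarrow> 'b::metric_space \<Rightarrow> 'b"
  assumes deg: "\<And>y. finite {y'. g x y' = y}" "\<And>y. card {y'. g x y' = y} = d" and d: "0 < d"
    and match: "\<And>y y'. \<exists>m. bij_betw m {a. g x a = y} {a. g x a = y'} \<and>
        (\<Sum>a | g x a = y. dist a (m a) powr \<alpha>) \<le> R * dist y y' powr \<alpha>"
    and \<phi>: "\<And>z. i \<le> \<phi> z" "\<And>z. \<phi> z \<le> i + \<epsilon>"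
      "\<And>a b. \<bar>exp (\<phi> (x, a)) - exp (\<phi> (x, b))\<bar> \<le> \<epsilon> * exp i * dist a b powr \<alpha>"
    and nn: "0 \<le> R" "0 \<le> \<epsilon>" "0 \<le> \<kappa>" "0 \<le> \<alpha>" and D: "\<And>y y' :: 'b. dist y y' \<le> D"
    and \<psi>: "hcone \<alpha> \<kappa> \<psi>"
  shows "hcone \<alpha> (exp \<epsilon> * R / d * (\<kappa> + \<epsilon> * (1 + \<kappa> * D powr \<alpha>))) (Lop g \<phi> x \<psi>)"
proof -
  define B where "B = 1 + \<kappa> * D powr \<alpha>"
  have B: "0 \<le> B" using nn by (simp add: B_def)
  have \<psi>0: "0 \<le> \<psi> y" for y using \<psi> by (rule hcone_nonneg)
  define Q where "Q = exp i * (exp \<epsilon> * (\<kappa> + \<epsilon> * B))"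
  have Q: "0 \<le> Q" using nn B by (simp add: Q_def)
  \<comment> \<open>The reference point \<open>w\<close> stays free; it is later set to each
    preimage of \<open>z\<close> in turn.\<close>
  have term_le: "\<bar>exp (\<phi> (x, a)) * \<psi> a - exp (\<phi> (x, b)) * \<psi> b\<bar> \<le> Q * \<psi> w * dist a b powr \<alpha>" for a b w
  proof -
    let ?D = "dist a b powr \<alpha>"
    have "\<bar>exp (\<phi> (x, a)) * \<psi> a - exp (\<phi> (x, b)) * \<psi> b\<bar>
        = \<bar>exp (\<phi> (x, a)) * (\<psi> a - \<psi> b) + (exp (\<phi> (x, a)) - exp (\<phi> (x, b))) * \<psi> b\<bar>"
      by (simp add: algebra_simps)
    also have "\<dots> \<le> exp (\<phi> (x, a)) * \<bar>\<psi> a - \<psi> b\<bar> + \<bar>exp (\<phi> (x, a)) - exp (\<phi> (x, b))\<bar> * \<psi> b"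
      by (rule order_trans[OF abs_triangle_ineq]) (simp add: abs_mult \<psi>0)
    also have "\<dots> \<le> exp (i + \<epsilon>) * (\<kappa> * \<psi> w * ?D) + (\<epsilon> * exp i * ?D) * (B * \<psi> w)"
    proof (intro add_mono mult_mono)
      show "\<psi> b \<le> B * \<psi> w" unfolding B_def by (rule hcone_le[OF \<psi> nn(3,4) D])
    qed (use \<phi> hcone_holder[OF \<psi>] \<psi>0 nn in auto)
    also have "\<dots> = exp i * (exp \<epsilon> * \<kappa> + 1 * (\<epsilon> * B)) * (\<psi> w * ?D)"
      by (simp add: exp_add algebra_simps)
    also have "\<dots> \<le> exp i * (exp \<epsilon> * \<kappa> + exp \<epsilon> * (\<epsilon> * B)) * (\<psi> w * ?D)"
      using nn B \<psi>0 by (intro mult_right_mono mult_left_mono add_left_mono) auto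
    also have "\<dots> = Q * \<psi> w * ?D" by (simp add: Q_def algebra_simps)
    finally show ?thesis .
  qed
  have diff: "\<bar>Lop g \<phi> x \<psi> y - Lop g \<phi> x \<psi> y'\<bar> \<le> Q * \<psi> w * (R * dist y y' powr \<alpha>)" for y y' w
  proof -
    obtain m where m: "bij_betw m {a. g x a = y} {a. g x a = y'}"
      "(\<Sum>a | g x a = y. dist a (m a) powr \<alpha>) \<le> R * dist y y' powr \<alpha>"
      using match[of y y'] by auto
    have "Lop g \<phi> x \<psi> y' = (\<Sum>a | g x a = y. exp (\<phi> (x, m a)) * \<psi> (m a))"
      unfolding Lop_def by (rule sum.reindex_bij_betw[OF m(1), symmetric])
    then have "\<bar>Lop g \<phi> x \<psi> y - Lop g \<phi> x \<psi> y'\<bar>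
        = \<bar>\<Sum>a | g x a = y. exp (\<phi> (x, a)) * \<psi> a - exp (\<phi> (x, m a)) * \<psi> (m a)\<bar>"
      by (simp add: Lop_def sum_subtractf)
    also have "\<dots> \<le> (\<Sum>a | g x a = y. Q * \<psi> w * dist a (m a) powr \<alpha>)"
      by (rule order_trans[OF sum_abs sum_mono[OF term_le]])
    also have "\<dots> = Q * \<psi> w * (\<Sum>a | g x a = y. dist a (m a) powr \<alpha>)"
      by (simp add: sum_distrib_left)
    also have "\<dots> \<le> Q * \<psi> w * (R * dist y y' powr \<alpha>)"
      using m(2) Q \<psi>0 by (intro mult_left_mono) auto
    finally show ?thesis .
  qed
  show ?thesis
    unfolding hcone_def
  proof (intro conjI allI)
    fix y show "0 \<le> Lop g \<phi> x \<psi> y" unfolding Lop_def by (intro sum_nonneg) (simp add: \<psi>0)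
  next
    fix y y' z :: 'b
    let ?\<Delta> = "\<bar>Lop g \<phi> x \<psi> y - Lop g \<phi> x \<psi> y'\<bar>" and ?D = "dist y y' powr \<alpha>"
    define P where "P = exp \<epsilon> * (\<kappa> + \<epsilon> * B) * R * ?D"
    have P: "0 \<le> P" using nn B by (simp add: P_def)
    \<comment> \<open>Summing one bound per preimage \<open>a\<close> of \<open>z\<close>, with
      \<open>a\<close> as reference point, turns the values \<open>exp i * \<psi> a\<close> into
      terms of \<open>Lop g \<phi> x \<psi> z\<close>, because \<open>exp i\<close> is below every
      weight.\<close>
    have "d * ?\<Delta> = (\<Sum>a | g x a = z. ?\<Delta>)" using deg by simp
    also have "\<dots> \<le> (\<Sum>a | g x a = z. P * (exp (\<phi> (x, a)) * \<psi> a))"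
    proof (rule sum_mono)
      fix a
      have "?\<Delta> \<le> P * (exp i * \<psi> a)" using diff[of y y' a] by (simp add: P_def Q_def algebra_simps)
      also have "\<dots> \<le> P * (exp (\<phi> (x, a)) * \<psi> a)"
        using P \<phi>(1) \<psi>0 by (intro mult_left_mono mult_right_mono) auto
      finally show "?\<Delta> \<le> P * (exp (\<phi> (x, a)) * \<psi> a)" .
    qed
    also have "\<dots> = P * Lop g \<phi> x \<psi> z" by (simp add: Lop_def sum_distrib_left)
    finally show "?\<Delta> \<le> exp \<epsilon> * R / d * (\<kappa> + \<epsilon> * (1 + \<kappa> * D powr \<alpha>)) * Lop g \<phi> x \<psi> z * ?D"
      using d by (simp add: P_def B_def field_simps)
  qed
qed

section \<open>Exponential convergence\<close>

lemma hcone_integrable: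
  fixes \<psi> :: "'b::metric_space \<Rightarrow> real"
  assumes "hcone \<alpha> \<kappa> \<psi>" "0 \<le> \<kappa>" "0 < \<alpha>" "\<And>y y' :: 'b. dist y y' \<le> D" and \<sigma>: "borel_prob \<sigma>"
  shows "integrable \<sigma> \<psi>"
proof -
  interpret prob_space \<sigma> using \<sigma> by (simp add: borel_prob_def)
  have "\<psi> \<in> borel_measurable borel"
    by (rule borel_measurable_continuous_onI[OF hcone_continuous]) (use assms in auto)
  then have "\<psi> \<in> borel_measurable \<sigma>"
    using \<sigma> by (simp add: borel_prob_def cong: measurable_cong_sets)
  moreover have "norm (\<psi> y) \<le> (1 + \<kappa> * D powr \<alpha>) * \<psi> undefined" for y
    using hcone_le[OF assms(1,2) less_imp_le[OF assms(3)] assms(4)] hcone_nonneg[OF assms(1)] by simp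
  ultimately show ?thesis by (intro integrable_const_bound) auto
qed

text \<open>The Harnack comparison with a fixed point puts a positive constant below \<psi>,
  whatever the measure.\<close>

lemma hcone_integral_pos:
  fixes \<psi> :: "'b::metric_space \<Rightarrow> real"
  assumes "hcone \<alpha> \<kappa> \<psi>" "0 \<le> \<kappa>" "0 < \<alpha>" "\<And>y y' :: 'b. dist y y' \<le> D" and \<sigma>: "borel_prob \<sigma>"
    and pos: "\<And>y. 0 < \<psi> y"
  shows "0 < (\<integral>y. \<psi> y \<partial>\<sigma>)"
proof -
  interpret prob_space \<sigma> using \<sigma> by (simp add: borel_prob_def)
  let ?B = "1 + \<kappa> * D powr \<alpha>"
  have B: "0 < ?B" using assms(2) by (intro add_pos_nonneg) auto
  have "0 < \<psi> undefined / ?B" using pos B by simp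
  also have "\<dots> = (\<integral>y. \<psi> undefined / ?B \<partial>\<sigma>)" by (simp add: prob_space)
  also have "\<dots> \<le> (\<integral>y. \<psi> y \<partial>\<sigma>)"
  proof (rule integral_mono)
    show "integrable \<sigma> \<psi>" by (rule hcone_integrable[OF assms(1-5)])
    show "\<psi> undefined / ?B \<le> \<psi> y" for y
      using hcone_le[OF assms(1,2) less_imp_le[OF assms(3)] assms(4)] B by (simp add: field_simps)
  qed simp
  finally show ?thesis .
qed

lemma abs_ln_diff_le:
  fixes a b p :: real
  assumes "0 < p" "p \<le> a" "p \<le> b" "\<bar>a - b\<bar> \<le> e"
  shows "\<bar>ln a - ln b\<bar> \<le> e / p"
proof -
  have *: "ln a - ln b \<le> e / p" if "p \<le> a" "p \<le> b" "a - b \<le> e" "0 \<le> e" for a b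
  proof -
    have "ln a - ln b \<le> (a - b) / b" using that assms(1) by (intro ln_diff_le) auto
    also have "\<dots> \<le> e / b" using that assms(1) by (intro divide_right_mono) auto
    also have "\<dots> \<le> e / p" using that assms(1) by (intro divide_left_mono) auto
    finally show ?thesis .
  qed
  show ?thesis using *[of a b] *[of b a] assms by (auto simp: abs_le_iff)
qed

lemma Lop_pos:
  assumes "finite {y'. g x y' = y}" "{y'. g x y' = y} \<noteq> {}" "\<And>y. 0 < \<psi> y"
  shows "0 < Lop g \<phi> x \<psi> y"
  unfolding Lop_def using assms by (intro sum_pos) auto

lemma contraction_constant:
  fixes \<kappa> \<kappa>' D \<alpha> :: real
  assumes \<kappa>: "0 < \<kappa>'" "\<kappa>' < \<kappa>"
  defines "c \<equiv> (\<kappa> - \<kappa>') / ((\<kappa> + \<kappa>') * (1 + \<kappa>' * D powr \<alpha>)\<^sup>2)"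
  shows "0 < c \<and> c < 1"
proof -
  define B where "B = (1 + \<kappa>' * D powr \<alpha>)\<^sup>2"
  have B: "1 \<le> B" unfolding B_def using \<kappa> by (intro one_le_power) simp
  have "\<kappa> - \<kappa>' < \<kappa> + \<kappa>'" using \<kappa> by simp
  also have "\<dots> \<le> (\<kappa> + \<kappa>') * B" using \<kappa> B by simp
  finally have "\<kappa> - \<kappa>' < (\<kappa> + \<kappa>') * B" .
  then show ?thesis using \<kappa> B unfolding c_def B_def[symmetric] by simp
qed

text \<open>\<open>Lop g \<phi> x (\<lambda>_. 1)\<close> and the constant 1 are both functions on
  the fibre over \<open>f x\<close>, and from there on the same operators move them. The gap
  iteration traps the quotient of their integrals between \<open>m'\<close> and \<open>M'\<close>
  for all measures and all times from \<open>k\<close> on; the logarithm is Lipschitz there because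
  \<open>m'\<close> is bounded below.\<close>

lemma Phi_n_contraction:
  fixes f :: "'a \<Rightarrow> 'a" and g :: "'a \<Rightarrow> 'b::metric_space \<Rightarrow> 'b"
  assumes fib: "\<And>x y. finite {y'. g x y' = y}" "\<And>x y. {y'. g x y' = y} \<noteq> {}"
    and T: "\<And>x \<psi>. hcone \<alpha> \<kappa> \<psi> \<Longrightarrow> hcone \<alpha> \<kappa>' (Lop g \<phi> x \<psi>)"
    and \<kappa>: "0 < \<kappa>'" "\<kappa>' < \<kappa>" and \<alpha>: "0 < \<alpha>" and D: "\<And>y y' :: 'b. dist y y' \<le> D"
    and ab: "0 < a" "\<And>x y. a \<le> Lop g \<phi> x (\<lambda>_. 1) y" "\<And>x y. Lop g \<phi> x (\<lambda>_. 1) y \<le> b"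
    and nm: "k \<le> n" "k \<le> m" and \<sigma>: "borel_prob \<sigma>" "borel_prob \<rho>"
  defines "c \<equiv> (\<kappa> - \<kappa>') / ((\<kappa> + \<kappa>') * (1 + \<kappa>' * D powr \<alpha>)\<^sup>2)"
  shows "\<bar>Phi_n f g \<phi> n \<sigma> x - Phi_n f g \<phi> m \<rho> x\<bar> \<le> 2 * b / (c * a) * (1 - c) ^ k"
proof -
  define u where "u n = Lpow f g \<phi> (Suc n) x (\<lambda>_. 1)" for n
  define v where "v n = Lpow f g \<phi> n (f x) (\<lambda>_. 1)" for n
  define S where "S n = Lop g \<phi> ((f ^^ n) (f x))" for n
  have c: "0 < c" "c < 1" using contraction_constant[OF \<kappa>, of D \<alpha>] by (auto simp: c_def)
  \<comment> \<open>The extra step in \<open>u\<close> aligns the indices: both sequences are driven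
    by the operator over \<open>(f ^^ Suc n) x\<close>.\<close>
  have u: "u (Suc n) = S n (u n)" and v: "v (Suc n) = S n (v n)" for n
    by (simp_all add: u_def v_def S_def funpow_swap1)
  have one: "hcone \<alpha> \<kappa> (\<lambda>_::'b. 1)" "hcone \<alpha> \<kappa>' (\<lambda>_::'b. 1)" using \<kappa> by (auto intro: hcone_const)
  have cone: "hcone \<alpha> \<kappa> (Lpow f g \<phi> n x (\<lambda>_. 1))" for n x
  proof (induction n)
    case (Suc n)
    then show ?case using \<kappa>(2) by (auto intro!: hcone_mono[OF T less_imp_le])
  qed (use one in simp)
  have pos: "0 < Lpow f g \<phi> n x (\<lambda>_. 1) y" for n x y
  proof (induction n arbitrary: y)
    case (Suc n)
    then show ?case using Lop_pos[of g "(f ^^ n) x", OF fib] by simp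
  qed simp
  have u0: "hcone \<alpha> \<kappa>' (u 0)" "a \<le> u 0 y" "u 0 y \<le> b" for y
    using T[OF one(1)] ab by (simp_all add: u_def)
  \<comment> \<open>The lower constant that \<open>hcone_subtract\<close> yields for
    \<open>u 0\<close> against the constant 1. It is at least \<open>c * a\<close>, which keeps the
    quotients away from 0.\<close>
  define m0 where "m0 = c * u 0 undefined"
  have b: "0 < b" using ab(1) u0(2,3)[of undefined] by linarith
  \<comment> \<open>The factor 2 gives \<open>2 * b - u 0 \<ge> b \<ge> u 0\<close>, so the Hoelder
    bound of \<open>u 0\<close> also serves this difference, whose oscillation is the same.\<close>
  have M: "hcone \<alpha> \<kappa> (\<lambda>y. 2 * b * v 0 y - u 0 y)"
    unfolding hcone_def
  proof (intro conjI allI)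
    fix y show "0 \<le> 2 * b * v 0 y - u 0 y" using u0(3)[of y] b by (simp add: v_def)
  next
    fix y y' z :: 'b
    have "\<bar>u 0 y - u 0 y'\<bar> \<le> \<kappa>' * u 0 z * dist y y' powr \<alpha>" using u0(1) by (rule hcone_holder)
    also have "\<dots> \<le> \<kappa> * (2 * b - u 0 z) * dist y y' powr \<alpha>"
      using \<kappa> u0(2,3)[of z] ab(1) by (intro mult_right_mono mult_mono) auto
    finally show "\<bar>2 * b * v 0 y - u 0 y - (2 * b * v 0 y' - u 0 y')\<bar>
        \<le> \<kappa> * (2 * b * v 0 z - u 0 z) * dist y y' powr \<alpha>"
      by (simp add: v_def abs_minus_commute)
  qed
  have m: "hcone \<alpha> \<kappa> (\<lambda>y. u 0 y - m0 * v 0 y)"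
    using hcone_subtract[OF u0(1) one(2) _ \<kappa> less_imp_le[OF \<alpha>] D, of undefined]
    by (simp add: m0_def v_def c_def)
  have "\<exists>M' m'. m0 \<le> m' \<and> M' - m' = (1 - c) ^ k * (2 * b - m0) \<and>
      (\<forall>n\<ge>k. \<forall>y. m' * v n y \<le> u n y \<and> u n y \<le> M' * v n y)"
    unfolding c_def
    by (rule hcone_gap_iterate[where T = S and u = u and v = v and D = D and \<alpha> = \<alpha> and \<kappa> = \<kappa> and \<kappa>' = \<kappa>'])
      (use T one(1) M m \<kappa> \<alpha> D u v pos in \<open>auto simp: S_def Lop_lin v_def\<close>)
  then obtain M' m' where *: "m0 \<le> m'" "M' - m' = (1 - c) ^ k * (2 * b - m0)"
    "\<And>n y. k \<le> n \<Longrightarrow> m' * v n y \<le> u n y" "\<And>n y. k \<le> n \<Longrightarrow> u n y \<le> M' * v n y"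
    by blast
  have "c * a \<le> m0" using c u0(2) by (simp add: m0_def)
  moreover have ca: "0 < c * a" using c ab by simp
  ultimately have m': "c * a \<le> m'" "0 \<le> m0" using *(1) by auto
  have gap: "M' - m' \<le> (1 - c) ^ k * (2 * b)"
    unfolding *(2) using c m' by (intro mult_left_mono) auto
  have ratio: "m' \<le> (\<integral>y. u n y \<partial>\<sigma>) / (\<integral>y. v n y \<partial>\<sigma>) \<and> (\<integral>y. u n y \<partial>\<sigma>) / (\<integral>y. v n y \<partial>\<sigma>) \<le> M'"
    if "borel_prob \<sigma>" "k \<le> n" for \<sigma> n
  proof -
    have \<kappa>0: "0 \<le> \<kappa>" using \<kappa> by simp
    have ui: "integrable \<sigma> (u n)" and vi: "integrable \<sigma> (v n)"
      unfolding u_def v_def by (rule hcone_integrable[OF cone \<kappa>0 \<alpha> D that(1)])+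
    have vp: "0 < (\<integral>y. v n y \<partial>\<sigma>)"
      unfolding v_def by (rule hcone_integral_pos[OF cone \<kappa>0 \<alpha> D that(1) pos])
    have "(\<integral>y. m' * v n y \<partial>\<sigma>) \<le> (\<integral>y. u n y \<partial>\<sigma>)" "(\<integral>y. u n y \<partial>\<sigma>) \<le> (\<integral>y. M' * v n y \<partial>\<sigma>)"
      by (rule integral_mono; use ui vi *(3,4)[OF that(2)] in simp)+
    then show ?thesis using vp by (simp add: field_simps)
  qed
  have "\<bar>Phi_n f g \<phi> n \<sigma> x - Phi_n f g \<phi> m \<rho> x\<bar> \<le> (1 - c) ^ k * (2 * b) / (c * a)"
    unfolding Phi_n_def u_def[symmetric] v_def[symmetric]
    using ratio[OF \<sigma>(1) nm(1)] ratio[OF \<sigma>(2) nm(2)] m' gap by (intro abs_ln_diff_le ca) auto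
  then show ?thesis by (simp add: mult_ac)
qed

text \<open>The estimate admits different measures on its two sides. A fixed \<open>\<rho>\<close>
  gives a Cauchy sequence, hence a limit; comparing any other measure with \<open>\<rho>\<close> and
  letting only \<open>m\<close> tend to infinity gives the rate, and so the same limit for every
  choice.\<close>

lemma uniform_geometric_limit:
  fixes P :: "nat \<Rightarrow> 's \<Rightarrow> 'x \<Rightarrow> real"
  assumes \<tau>: "0 < \<tau>" "\<tau> < 1" and "Q \<rho>"
    and P: "\<And>k n m x \<sigma> \<sigma>'. k \<le> n \<Longrightarrow> k \<le> m \<Longrightarrow> Q \<sigma> \<Longrightarrow> Q \<sigma>' \<Longrightarrow> \<bar>P n \<sigma> x - P m \<sigma>' x\<bar> \<le> C * \<tau> ^ k"
  shows "\<exists>\<Phi>. \<forall>\<sigma>s. (\<forall>n. Q (\<sigma>s n)) \<longrightarrow>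
    (\<forall>x. (\<lambda>n. P n (\<sigma>s n) x) \<longlonglongrightarrow> \<Phi> x \<and> (\<forall>n. \<bar>P n (\<sigma>s n) x - \<Phi> x\<bar> \<le> C * \<tau> ^ n))"
proof -
  have lim0: "(\<lambda>k. C * \<tau> ^ k) \<longlonglongrightarrow> 0"
    using tendsto_mult_right_zero[OF LIMSEQ_power_zero[of \<tau>]] \<tau> by simp
  have "convergent (\<lambda>n. P n \<rho> x)" for x
  proof (rule Cauchy_convergent[OF metric_CauchyI])
    fix e :: real assume "0 < e"
    then obtain k where k: "C * \<tau> ^ k < e"
      using order_tendstoD(2)[OF lim0] eventually_happens'[OF sequentially_bot] by blast
    have "dist (P m \<rho> x) (P n \<rho> x) < e" if "k \<le> m" "k \<le> n" for m n
      using P[OF that \<open>Q \<rho>\<close> \<open>Q \<rho>\<close>, of x] k by (simp add: dist_real_def)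
    then show "\<exists>K. \<forall>m\<ge>K. \<forall>n\<ge>K. dist (P m \<rho> x) (P n \<rho> x) < e" by auto
  qed
  then obtain \<Phi> where \<Phi>: "\<And>x. (\<lambda>n. P n \<rho> x) \<longlonglongrightarrow> \<Phi> x" unfolding convergent_def by metis
  have close: "\<bar>P n \<sigma> x - \<Phi> x\<bar> \<le> C * \<tau> ^ n" if "Q \<sigma>" for n \<sigma> x
  proof (rule Lim_bounded)
    show "(\<lambda>m. \<bar>P n \<sigma> x - P m \<rho> x\<bar>) \<longlonglongrightarrow> \<bar>P n \<sigma> x - \<Phi> x\<bar>"
      by (intro tendsto_intros \<Phi>)
    show "\<forall>m\<ge>n. \<bar>P n \<sigma> x - P m \<rho> x\<bar> \<le> C * \<tau> ^ n" using P that \<open>Q \<rho>\<close> by auto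
  qed
  have "(\<lambda>n. P n (\<sigma>s n) x) \<longlonglongrightarrow> \<Phi> x" if "\<And>n. Q (\<sigma>s n)" for \<sigma>s x
    by (rule Lim_transform_bound[OF _ lim0, THEN LIM_zero_cancel])
      (auto intro!: always_eventually order_trans[OF close[OF that] abs_ge_self])
  then show ?thesis using close by (intro exI[of _ \<Phi>]) auto
qed

text \<open>The supremum is an upper bound only once the quotients are bounded, which the crude
  constant \<open>H\<close> ensures.\<close>

lemma holder_seminorm_bound:
  fixes h :: "'a::metric_space \<times> 'b::metric_space \<Rightarrow> real"
  assumes "\<And>z w. \<bar>h z - h w\<bar> \<le> H * pdist z w powr \<alpha>"
  shows "\<bar>h z - h w\<bar> \<le> holder_seminorm \<alpha> h * pdist z w powr \<alpha>"
proof (cases "z = w")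
  case False
  have pos: "0 < pdist z w powr \<alpha>" if "z \<noteq> w" for z w :: "'a \<times> 'b"
  proof -
    have "pdist z w \<noteq> 0" using that by (simp add: pdist_def add_nonneg_eq_0_iff prod_eq_iff)
    then show ?thesis by simp
  qed
  have "\<bar>h z - h w\<bar> / pdist z w powr \<alpha> \<le> holder_seminorm \<alpha> h"
    unfolding holder_seminorm_def
  proof (rule cSUP_upper2[where x = "(z, w)"])
    show "bdd_above ((\<lambda>p. \<bar>h (fst p) - h (snd p)\<bar> / pdist (fst p) (snd p) powr \<alpha>) ` {(z, w). z \<noteq> w})"
    proof (rule bdd_aboveI2[where M = H])
      fix p :: "('a \<times> 'b) \<times> ('a \<times> 'b)" assume "p \<in> {(z, w). z \<noteq> w}"
      then have "0 < pdist (fst p) (snd p) powr \<alpha>" by (intro pos) auto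
      then show "\<bar>h (fst p) - h (snd p)\<bar> / pdist (fst p) (snd p) powr \<alpha> \<le> H"
        using assms[of "fst p" "snd p"] by (simp add: pos_divide_le_eq)
    qed
  qed (use False in auto)
  then show ?thesis using pos[OF False] by (simp add: pos_divide_le_eq)
qed (simp add: pdist_def)

lemma abs_exp_diff_le:
  fixes a b M :: real
  assumes "a \<le> M" "b \<le> M"
  shows "\<bar>exp a - exp b\<bar> \<le> exp M * \<bar>a - b\<bar>"
proof -
  have *: "exp b - exp a \<le> exp M * (b - a)" if "a \<le> b" "b \<le> M" for a b :: real
  proof -
    have "exp b - exp a = exp b * (1 - exp (a - b))" by (simp add: exp_diff field_simps)
    also have "\<dots> \<le> exp M * (b - a)"
      using that exp_ge_add_one_self[of "a - b"] by (intro mult_mono) (auto simp: algebra_simps)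
    finally show ?thesis .
  qed
  show ?thesis using *[of a b] *[of b a] assms by (cases "a \<le> b") auto
qed

theorem theorem3p4:
  fixes f :: "'a::metric_space \<Rightarrow> 'a"
    and g :: "'a \<Rightarrow> 'b::metric_space \<Rightarrow> 'b"
    and \<phi> :: "'a \<times> 'b \<Rightarrow> real"
    and Lz :: "'a \<times> 'b \<Rightarrow> real"
    and \<A> :: "('a \<times> 'b) set"
    and \<U> :: "('a \<times> 'b) set set"
    and \<gamma> \<delta>f L \<alpha> \<epsilon> :: real
    and d q :: nat
  assumes X_compact: "compact (UNIV :: 'a set)" and X_connected: "connected (UNIV :: 'a set)"
    and Y_compact: "compact (UNIV :: 'b set)" and Y_connected: "connected (UNIV :: 'b set)"
    and X_geodesic: "geodesic_space (dist :: 'a \<Rightarrow> 'a \<Rightarrow> real)"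
    and Y_geodesic: "geodesic_space (dist :: 'b \<Rightarrow> 'b \<Rightarrow> real)"
    and F_lipschitz: "\<exists>K. \<forall>z w. pdist (skew f g z) (skew f g w) \<le> K * pdist z w"
    and F_local_homeo: "local_homeo (skew f g)"
    and expanding: "\<gamma> > 1" "\<delta>f > 0" "\<forall>x x'. dist x x' \<le> \<delta>f \<longrightarrow> dist (f x) (f x') \<ge> \<gamma> * dist x x'"
    and degree: "\<forall>x y. finite {y'. g x y' = y} \<and> card {y'. g x y' = y} = d"
    and Lz_cont: "continuous_on UNIV Lz"
    and Lz_inverse: "\<forall>z. \<exists>U. open U \<and> z \<in> U \<and> inj_on (skew f g) U \<and>
         (\<forall>w\<in>U. \<forall>w'\<in>U. pdist w w' \<le> Lz z * pdist (skew f g w) (skew f g w'))"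
    and A1: "L \<ge> 1" "open \<A>" "\<forall>z\<in>\<A>. Lz z \<le> L" "\<forall>z. z \<notin> \<A> \<longrightarrow> Lz z < 1 / \<gamma>"
    and A2_cover: "finite \<U>" "\<forall>U\<in>\<U>. open U \<and> inj_on (skew f g) U" "\<Union>\<U> = UNIV"
    and A2_A: "q < d" "\<exists>\<V>\<subseteq>\<U>. card \<V> = q \<and> \<A> \<subseteq> \<Union>\<V>"
    and A2_curves: "\<forall>U\<in>\<U>. \<forall>l c. min_geodesic pdist l c \<longrightarrow>
         (\<forall>c1 c2. continuous_on {0..l} c1 \<and> (\<forall>t\<in>{0..l}. skew f g (c1 t) = c t) \<and> c1 ` {0..l} \<inter> U \<noteq> {} \<and>
                  continuous_on {0..l} c2 \<and> (\<forall>t\<in>{0..l}. skew f g (c2 t) = c t) \<and> c2 ` {0..l} \<inter> U \<noteq> {}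
                  \<longrightarrow> c1 ` {0..l} = c2 ` {0..l})"
    and alpha: "0 < \<alpha>" "\<alpha> < 1"
    and phi_holder: "\<exists>H. \<forall>z w. \<bar>\<phi> z - \<phi> w\<bar> \<le> H * pdist z w powr \<alpha>"
    and eps: "\<epsilon> > 0"
      "exp \<epsilon> * ((real d - real q) * \<gamma> powr (-\<alpha>) + real q * L powr \<alpha>) / real d < 1"
      "exp \<epsilon> * ((real d - real q) * \<gamma> powr (-\<alpha>) + real q * L powr \<alpha>) / real d
         + 2 * (exp \<epsilon> * ((real d - real q) * \<gamma> powr (-\<alpha>) + real q * L powr \<alpha>) / real d)
           * \<epsilon> * diameter (UNIV :: 'b set) powr \<alpha> < 1"
    and P1: "Sup (range \<phi>) - Inf (range \<phi>) < \<epsilon>"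
    and P2: "holder_seminorm \<alpha> (\<lambda>z. exp (\<phi> z)) < \<epsilon> * exp (Inf (range \<phi>))"
  shows "\<exists>\<tau> C1. 0 < \<tau> \<and> \<tau> < 1 \<and> C1 > 0 \<and>
     (\<forall>k n m x \<sigma>n \<sigma>m. k \<le> n \<and> k \<le> m \<and> borel_prob \<sigma>n \<and> borel_prob \<sigma>m \<longrightarrow>
        \<bar>Phi_n f g \<phi> n \<sigma>n x - Phi_n f g \<phi> m \<sigma>m x\<bar> \<le> C1 * \<tau> ^ k) \<and>
     (\<exists>\<Phi>. \<forall>\<sigma>s. (\<forall>n. borel_prob (\<sigma>s n)) \<longrightarrow>
        (\<forall>x. (\<lambda>n. Phi_n f g \<phi> n (\<sigma>s n) x) \<longlonglongrightarrow> \<Phi> x \<and>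
             (\<forall>n. \<bar>Phi_n f g \<phi> n (\<sigma>s n) x - \<Phi> x\<bar> \<le> C1 * \<tau> ^ n)))"
proof -
  define D where "D = diameter (UNIV :: 'b set)"
  define R where "R = (real d - real q) * \<gamma> powr - \<alpha> + real q * L powr \<alpha>"
  define s where "s = exp \<epsilon> * R / real d"
  define i where "i = Inf (range \<phi>)"
  have D: "dist y y' \<le> D" for y y' :: 'b
    unfolding D_def using diameter_bounded_bound[OF compact_imp_bounded[OF Y_compact]] by simp
  have d: "0 < d" using A2_A(1) by simp
  have f: "\<And>x x'. dist x x' \<le> \<delta>f \<Longrightarrow> \<gamma> * dist x x' \<le> dist (f x) (f x')"
    using expanding(3) by simp
  have deg: "\<And>x y. finite {y'. g x y' = y}" "\<And>x y. card {y'. g x y' = y} = d"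
    using degree by auto
  have fib_ne: "{y'. g x y' = y} \<noteq> {}" for x y
    using deg(2)[of x y] d by (metis card.empty less_irrefl)

  \<comment> \<open>Bounds for the potential and its exponential\<close>
  obtain H where H: "\<And>z w. \<bar>\<phi> z - \<phi> w\<bar> \<le> H * pdist z w powr \<alpha>" using phi_holder by blast
  obtain DX where DX: "\<And>x x' :: 'a. dist x x' \<le> DX"
    using compact_imp_bounded[OF X_compact] unfolding bounded_two_points by auto
  \<comment> \<open>Finite diameters make \<phi> bounded, so that \<open>Inf (range \<phi>)\<close>
    and \<open>Sup (range \<phi>)\<close> really bound its values.\<close>
  have \<phi>_bdd: "\<bar>\<phi> z - \<phi> w\<bar> \<le> \<bar>H\<bar> * (DX + D) powr \<alpha>" for z w
  proof -
    have "\<bar>\<phi> z - \<phi> w\<bar> \<le> \<bar>H\<bar> * pdist z w powr \<alpha>"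
      by (rule order_trans[OF H mult_right_mono]) auto
    also have "\<dots> \<le> \<bar>H\<bar> * (DX + D) powr \<alpha>"
      using alpha(1) DX D by (intro mult_left_mono powr_mono2) (auto simp: pdist_def intro: add_mono)
    finally show ?thesis .
  qed
  have bdd: "bdd_below (range \<phi>)" "bdd_above (range \<phi>)"
    using \<phi>_bdd[of undefined]
    by (auto intro!: bdd_belowI2[where m = "\<phi> undefined - \<bar>H\<bar> * (DX + D) powr \<alpha>"]
        bdd_aboveI2[where M = "\<phi> undefined + \<bar>H\<bar> * (DX + D) powr \<alpha>"] simp: abs_le_iff algebra_simps)
  have \<phi>1: "i \<le> \<phi> z" for z unfolding i_def by (intro cINF_lower bdd) simp
  have \<phi>S: "\<phi> z \<le> Sup (range \<phi>)" for z by (intro cSUP_upper bdd) simp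
  have \<phi>2: "\<phi> z \<le> i + \<epsilon>" for z using \<phi>S[of z] P1 by (simp add: i_def)
  \<comment> \<open>A crude Hoelder constant for \<open>exp \<phi>\<close> comes first, to make
    \<open>holder_seminorm\<close> a genuine supremum; the small constant then comes from
    \<open>P2\<close>.\<close>
  have "\<bar>exp (\<phi> z) - exp (\<phi> w)\<bar> \<le> (exp (i + \<epsilon>) * H) * pdist z w powr \<alpha>" for z w
  proof -
    have "\<bar>exp (\<phi> z) - exp (\<phi> w)\<bar> \<le> exp (i + \<epsilon>) * \<bar>\<phi> z - \<phi> w\<bar>"
      by (intro abs_exp_diff_le \<phi>2)
    also have "\<dots> \<le> exp (i + \<epsilon>) * (H * pdist z w powr \<alpha>)" by (intro mult_left_mono H) simp
    finally show ?thesis by (simp add: mult_ac)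
  qed
  note seminorm = holder_seminorm_bound[where h = "\<lambda>z. exp (\<phi> z)", OF this]
  have \<phi>3: "\<bar>exp (\<phi> (x, a)) - exp (\<phi> (x, b))\<bar> \<le> \<epsilon> * exp i * dist a b powr \<alpha>" for x a b
  proof -
    have "\<bar>exp (\<phi> (x, a)) - exp (\<phi> (x, b))\<bar> \<le> holder_seminorm \<alpha> (\<lambda>z. exp (\<phi> z)) * dist a b powr \<alpha>"
      using seminorm[of "(x, a)" "(x, b)"] by (simp add: pdist_def)
    also have "\<dots> \<le> \<epsilon> * exp i * dist a b powr \<alpha>"
      using P2 by (intro mult_right_mono) (auto simp: i_def)
    finally show ?thesis .
  qed

  \<comment> \<open>Sums of distances over matched preimages\<close>
  have powr_bounds: "0 < \<gamma> powr - \<alpha>" "\<gamma> powr - \<alpha> \<le> 1" "1 \<le> L powr \<alpha>"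
    using expanding(1) alpha(1) A1(1) by (auto simp: powr_minus field_simps ge_one_powr_ge_zero)
  have R: "0 < R" unfolding R_def using powr_bounds A2_A(1) by (intro add_pos_nonneg) auto
  obtain V where V: "V \<subseteq> \<U>" "card V = q" "\<A> \<subseteq> \<Union>V" using A2_A(2) by blast
  have match: "\<exists>m. bij_betw m {a. g x a = y} {a. g x a = y'} \<and>
      (\<Sum>a | g x a = y. dist a (m a) powr \<alpha>) \<le> R * dist y y' powr \<alpha>" for x y y'
  proof -
    obtain m B where m: "bij_betw m {a. g x a = y} {a. g x a = y'}" "B \<subseteq> {a. g x a = y}" "card B \<le> card V"
      "\<And>a. a \<in> B \<Longrightarrow> dist a (m a) \<le> L * dist y y'"
      "\<And>a. g x a = y \<Longrightarrow> a \<notin> B \<Longrightarrow> dist a (m a) \<le> 1 / \<gamma> * dist y y'"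
    proof (rule preimage_matching[where f = f and g = g and x = x and y = y and y' = y' and V = V and A = \<A>
          and L = L and Lz = Lz, OF Y_geodesic F_local_homeo expanding(1,2) f deg])
      show "finite V" using V(1) A2_cover(1) by (rule finite_subset)
      fix U l c c1 c2
      assume "U \<in> V" "min_geodesic pdist l c"
        "continuous_on {0..l} c1" "\<And>t. t \<in> {0..l} \<Longrightarrow> skew f g (c1 t) = c t" "c1 ` {0..l} \<inter> U \<noteq> {}"
        "continuous_on {0..l} c2" "\<And>t. t \<in> {0..l} \<Longrightarrow> skew f g (c2 t) = c t" "c2 ` {0..l} \<inter> U \<noteq> {}"
      then show "c1 ` {0..l} = c2 ` {0..l}" using A2_curves V(1) by (meson subsetD)
    qed (use A1 Lz_inverse V(3) in auto)
    let ?A = "{a. g x a = y}" and ?D = "dist y y' powr \<alpha>"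
    have "(\<Sum>a\<in>?A. dist a (m a) powr \<alpha>) = (\<Sum>a\<in>?A - B. dist a (m a) powr \<alpha>) + (\<Sum>a\<in>B. dist a (m a) powr \<alpha>)"
      by (rule sum.subset_diff[OF m(2) deg(1)])
    also have "\<dots> \<le> (\<Sum>a\<in>?A - B. \<gamma> powr - \<alpha> * ?D) + (\<Sum>a\<in>B. L powr \<alpha> * ?D)"
    proof (intro add_mono sum_mono)
      fix a assume "a \<in> ?A - B"
      then have "dist a (m a) powr \<alpha> \<le> (1 / \<gamma> * dist y y') powr \<alpha>"
        using alpha(1) m(5) by (intro powr_mono2) auto
      also have "\<dots> = \<gamma> powr - \<alpha> * ?D"
        using expanding(1) by (simp add: powr_divide powr_minus_divide)
      finally show "dist a (m a) powr \<alpha> \<le> \<gamma> powr - \<alpha> * ?D" .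
    next
      fix a assume "a \<in> B"
      then have "dist a (m a) powr \<alpha> \<le> (L * dist y y') powr \<alpha>"
        using alpha(1) m(4) by (intro powr_mono2) auto
      also have "\<dots> = L powr \<alpha> * ?D" using A1(1) by (simp add: powr_mult)
      finally show "dist a (m a) powr \<alpha> \<le> L powr \<alpha> * ?D" .
    qed
    also have "\<dots> = (real (card (?A - B)) * \<gamma> powr - \<alpha> + real (card B) * L powr \<alpha>) * ?D"
      by (simp add: algebra_simps)
    also have "real (card (?A - B)) = real d - real (card B)"
      using card_Diff_subset[OF finite_subset[OF m(2) deg(1)] m(2)] card_mono[OF deg(1) m(2)] deg(2) by simp
    also have "((real d - real (card B)) * \<gamma> powr - \<alpha> + real (card B) * L powr \<alpha>) * ?D \<le> R * ?D"
    proof (rule mult_right_mono)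
      \<comment> \<open>Since \<open>\<gamma> powr - \<alpha> \<le> 1 \<le> L powr \<alpha>\<close>,
        the bound grows with the number of exceptional pairs, so \<open>q\<close> of them are the
        worst case.\<close>
      have "real (card B) * (L powr \<alpha> - \<gamma> powr - \<alpha>) \<le> real q * (L powr \<alpha> - \<gamma> powr - \<alpha>)"
        using m(3) V(2) powr_bounds by (intro mult_right_mono) auto
      then show "(real d - real (card B)) * \<gamma> powr - \<alpha> + real (card B) * L powr \<alpha> \<le> R"
        by (simp add: R_def algebra_simps)
    qed simp
    finally show ?thesis using m(1) by blast
  qed

  \<comment> \<open>Choice of the cone constants\<close>
  have s0: "0 < s" using R d by (simp add: s_def)
  \<comment> \<open>\<theta> collects the terms of the bound in \<open>Lop_hcone\<close> that are
    proportional to \<kappa>; \<open>eps(3)\<close> makes it less than 1.\<close>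
  define \<theta> where "\<theta> = s + s * \<epsilon> * D powr \<alpha>"
  have "0 \<le> s * \<epsilon> * D powr \<alpha>" using s0 eps(1) by simp
  moreover have "s + 2 * s * \<epsilon> * D powr \<alpha> < 1" using eps(3) by (simp only: s_def R_def D_def)
  ultimately have \<theta>: "\<theta> < 1" by (simp add: \<theta>_def)
  text \<open>With this \<^term>\<open>\<kappa>\<close> the Lasota--Yorke type bound
    \<open>\<kappa> \<mapsto> \<theta> \<kappa> + s \<epsilon>\<close> of \<open>Lop_hcone\<close> takes the value \<open>\<kappa> - 1\<close>.\<close>
  define \<kappa> where "\<kappa> = (s * \<epsilon> + 1) / (1 - \<theta>)"
  define \<kappa>' where "\<kappa>' = s * (\<kappa> + \<epsilon> * (1 + \<kappa> * D powr \<alpha>))"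
  have \<kappa>0: "0 < \<kappa>" unfolding \<kappa>_def using s0 eps(1) \<theta> by (intro divide_pos_pos add_pos_pos) auto
  have "\<kappa> * (1 - \<theta>) = s * \<epsilon> + 1" using \<theta> by (simp add: \<kappa>_def)
  then have "\<kappa>' = \<kappa> - 1" by (simp add: \<kappa>'_def \<theta>_def algebra_simps)
  moreover have "0 < \<kappa>'" unfolding \<kappa>'_def
    using s0 \<kappa>0 eps(1) by (intro mult_pos_pos add_pos_nonneg mult_nonneg_nonneg) auto
  ultimately have \<kappa>: "0 < \<kappa>'" "\<kappa>' < \<kappa>" by auto
  have T: "hcone \<alpha> \<kappa>' (Lop g \<phi> x \<psi>)" if "hcone \<alpha> \<kappa> \<psi>" for x \<psi>
    unfolding \<kappa>'_def s_def
    by (rule Lop_hcone[where i = i, OF deg d match \<phi>1 \<phi>2 \<phi>3 _ _ _ _ D that])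
      (use R eps(1) \<kappa>0 alpha(1) in auto)

  \<comment> \<open>Uniform rate and limit\<close>
  define a where "a = real d * exp i"
  define b where "b = real d * exp (i + \<epsilon>)"
  have a0: "0 < a" using d by (simp add: a_def)
  have lower: "a \<le> Lop g \<phi> x (\<lambda>_. 1) y" and upper: "Lop g \<phi> x (\<lambda>_. 1) y \<le> b" for x y
    using sum_bounded_below[of "{y'. g x y' = y}" "exp i" "\<lambda>y'. exp (\<phi> (x, y'))"]
      sum_bounded_above[of "{y'. g x y' = y}" "\<lambda>y'. exp (\<phi> (x, y'))" "exp (i + \<epsilon>)"] deg \<phi>1 \<phi>2
    by (auto simp: Lop_def a_def b_def)
  define c where "c = (\<kappa> - \<kappa>') / ((\<kappa> + \<kappa>') * (1 + \<kappa>' * D powr \<alpha>)\<^sup>2)"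
  define C where "C = 2 * b / (c * a)"
  define \<tau> where "\<tau> = 1 - c"
  have c: "0 < c" "c < 1" using contraction_constant[OF \<kappa>, of D \<alpha>] by (auto simp: c_def)
  have \<tau>: "0 < \<tau>" "\<tau> < 1" using c by (auto simp: \<tau>_def)
  have C: "0 < C" using c d by (simp add: C_def a_def b_def)
  have main: "\<bar>Phi_n f g \<phi> n \<sigma> x - Phi_n f g \<phi> m \<rho> x\<bar> \<le> C * \<tau> ^ k"
    if "k \<le> n" "k \<le> m" "borel_prob \<sigma>" "borel_prob \<rho>" for k n m x \<sigma> \<rho>
    unfolding C_def \<tau>_def c_def
    by (rule Phi_n_contraction[OF deg(1) fib_ne T \<kappa> alpha(1) D a0 lower upper that])
  \<comment> \<open>A point mass serves as the reference measure that defines the limit.\<close>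
  have "borel_prob (return borel (undefined :: 'b))"
    by (simp add: borel_prob_def prob_space_return)
  from uniform_geometric_limit[where P = "Phi_n f g \<phi>" and Q = borel_prob, OF \<tau> this main]
  show ?thesis using \<tau> C main by (intro exI[of _ \<tau>] exI[of _ C] conjI) auto
qed

end
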